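(* Let $S$ be a connected compact surface and let $(K,M_V)$ be a discrete gradient line field on $S$, with $K=(V,E,F)$. Then $$\chi(S)=\sum_{v\in V}\mathrm{index}(v)+\sum_{\Sigma\in F}\mathrm{index}(\Sigma).$$
   Context: Surfaces are without boundary. A decomposition $K=(V,E,F)$ of a connected compact surface $S$ is given by a finite graph $(V,E)$ embedded in $S$ such that every connected component of the complement is homeomorphic to an open disc; $F$ is the set of these components (the faces, or 2-cells). The edges and vertices in the boundary of a face $\Sigma$ form a closed walk in the graph, the boundary walk of $\Sigma$; every edge occurs exactly twice in total in the boundary walks of all faces (possibly twice in the same one), and occurrences are counted with multiplicity. The Hasse diagram $H(K)$ is the graph whose vertices are the cells of $K$ and whose edges join incident cells whose dimensions differ by one (one edge per incidence). $H_V$ is the subgraph formed by the edges of $H(K)$ joining a vertex of $K$ to an edge of $K$. A Morse matching $M_V$ on $H_V$ is a collection of pairwise disjoint edges of $H_V$ that does not contain a set of alternate edges of a closed cycle of $H_V$. A discrete gradient line field on $S$ is a pair $(K,M_V)$, where $K$ is a decomposition of $S$ and $M_V$ is a Morse matching on $H_V$. A vertex $v\in V$ is critical if it is unmatched in $M_V$; $\mathrm{index}(v)=1$ if $v$ is critical and $0$ otherwise. For a face $\Sigma$, let $C(\Sigma)$ be the number of edges unmatched in $M_V$ in the boundary walk of $\Sigma$ (with multiplicity); $\mathrm{index}(\Sigma)=1-C(\Sigma)/2$. *)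

theory Defs
  imports "HOL-Homology.Homology"
begin

section \<open>Euler characteristic\<close>

text \<open>
  The homology groups of the library are written multiplicatively and indexed by integers
  (they are trivial in negative degree). Their rank is the maximal number of elements that
  are linearly independent over the integers. The \<open>Sup\<close> below and the sum
  over \<open>p\<close> are meaningful for spaces with finitely many nonzero Betti numbers, all of
  them finite; compact surfaces are such spaces.
\<close>

definition int_independent :: "('g, 'm) monoid_scheme \<Rightarrow> 'g set \<Rightarrow> bool" where
  "int_independent G B \<longleftrightarrow>
     finite B \<and> B \<subseteq> carrier G \<and>
     (\<forall>c :: 'g \<Rightarrow> int. finprod G (\<lambda>x. x [^]\<^bsub>G\<^esub> c x) B = \<one>\<^bsub>G\<^esub> \<longrightarrow> (\<forall>x\<in>B. c x = 0))"

definition abelian_rank :: "('g, 'm) monoid_scheme \<Rightarrow> nat" where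
  "abelian_rank G = Sup (card ` {B. int_independent G B})"

definition betti :: "int \<Rightarrow> 'a topology \<Rightarrow> nat" where
  "betti p X = abelian_rank (homology_group p X)"

definition euler_characteristic :: "'a topology \<Rightarrow> int" where
  "euler_characteristic X = (\<Sum>p | betti p X \<noteq> 0. (- 1) ^ nat p * int (betti p X))"


section \<open>Surfaces and their decompositions\<close>

text \<open>The Euclidean plane is represented by the complex numbers throughout. Second countability
  is not listed because it follows from compactness.\<close>

definition connected_compact_surface :: "'a topology \<Rightarrow> bool" where
  "connected_compact_surface S \<longleftrightarrow>
     connected_space S \<and> compact_space S \<and> Hausdorff_space S \<and>
     (\<forall>x\<in>topspace S. \<exists>U. openin S U \<and> x \<in> U \<and>
        subtopology S U homeomorphic_space (euclidean :: complex topology))"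

text \<open>
  Edges are labels, and each edge carries a parametrization of its closure by the unit
  interval. A traversal of an edge is a pair of a label and a flag; the flag is set if the edge
  is traversed against its parametrization. The field \<open>walk\<close> assigns to each face its boundary
  walk, as a list of traversals, with an arbitrary choice of starting point and direction.
\<close>

record ('a, 'e) cell_decomposition =
  verts :: "'a set"
  edges :: "'e set"
  epath :: "'e \<Rightarrow> real \<Rightarrow> 'a"
  walk :: "'a set \<Rightarrow> ('e \<times> bool) list"

definition open_edge :: "('a, 'e, 'm) cell_decomposition_scheme \<Rightarrow> 'e \<Rightarrow> 'a set" where
  "open_edge K e = epath K e ` {0<..<1}"

definition edge_end :: "('a, 'e, 'm) cell_decomposition_scheme \<Rightarrow> 'e \<Rightarrow> bool \<Rightarrow> 'a" where
  "edge_end K e b = epath K e (if b then 1 else 0)"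

text \<open>Loops and multiple edges are allowed.\<close>

definition embedded_finite_graph ::
  "'a topology \<Rightarrow> ('a, 'e, 'm) cell_decomposition_scheme \<Rightarrow> bool" where
  "embedded_finite_graph S K \<longleftrightarrow>
     finite (verts K) \<and> verts K \<subseteq> topspace S \<and> finite (edges K) \<and>
     (\<forall>e\<in>edges K.
        pathin S (epath K e) \<and> inj_on (epath K e) {0<..<1} \<and>
        (\<forall>b. edge_end K e b \<in> verts K) \<and> disjnt (open_edge K e) (verts K)) \<and>
     pairwise (\<lambda>e e'. disjnt (open_edge K e) (open_edge K e')) (edges K)"

definition faces :: "'a topology \<Rightarrow> ('a, 'e, 'm) cell_decomposition_scheme \<Rightarrow> 'a set set" where
  "faces S K = connected_components_of
     (subtopology S (topspace S - (verts K \<union> (\<Union>e\<in>edges K. open_edge K e))))"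

definition traversal :: "('a, 'e, 'm) cell_decomposition_scheme \<Rightarrow> 'e \<times> bool \<Rightarrow> real \<Rightarrow> 'a" where
  "traversal K d t = epath K (fst d) (if snd d then 1 - t else t)"

text \<open>
  A closed walk is the boundary walk of a face \<open>\<Sigma>\<close> if \<open>\<Sigma>\<close> is the homeomorphic image of the
  interior of a polygon, by a map that extends continuously to the closed polygon and
  takes its successive sides to the successive traversals of the walk. The polygon is the closed
  unit disc with its boundary circle divided into \<open>n\<close> equal arcs. For \<open>n = 0\<close> the circle is
  mapped to a single vertex; this happens for the decomposition of the sphere whose
  graph is one vertex without edges.
\<close>

definition boundary_walk ::
  "'a topology \<Rightarrow> ('a, 'e, 'm) cell_decomposition_scheme \<Rightarrow> 'a set \<Rightarrow> ('e \<times> bool) list \<Rightarrow> bool" where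
  "boundary_walk S K \<Sigma> w \<longleftrightarrow>
     fst ` set w \<subseteq> edges K \<and>
     (\<exists>h. continuous_map (top_of_set (cball (0::complex) 1)) S h \<and>
          homeomorphic_map (top_of_set (ball (0::complex) 1)) (subtopology S \<Sigma>) h \<and>
          (if w = [] then \<exists>v\<in>verts K. \<forall>z\<in>sphere 0 1. h z = v
           else \<forall>i<length w. \<forall>t\<in>{0..1}.
                  h (cis (2 * pi * (real i + t) / real (length w))) = traversal K (w ! i) t))"

definition decomposition ::
  "'a topology \<Rightarrow> ('a, 'e, 'm) cell_decomposition_scheme \<Rightarrow> bool" where
  "decomposition S K \<longleftrightarrow>
     embedded_finite_graph S K \<and>
     (\<forall>\<Sigma>\<in>faces S K.
        subtopology S \<Sigma> homeomorphic_space top_of_set (ball (0::complex) 1) \<and>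
        boundary_walk S K \<Sigma> (walk K \<Sigma>)) \<and>
     (\<forall>e\<in>edges K.
        card {(\<Sigma>, i). \<Sigma> \<in> faces S K \<and> i < length (walk K \<Sigma>) \<and> fst (walk K \<Sigma> ! i) = e} = 2)"


section \<open>Hasse diagram and Morse matchings\<close>

datatype ('a, 'e) cell = VCell 'a | ECell 'e | FCell "'a set"

text \<open>
  The Hasse diagram is a multigraph on the cells, with one edge for each incidence:
  \<open>VE e b\<close> is the incidence of \<open>e\<close> with the vertex at its end \<open>b\<close> (so a loop is joined to its
  vertex by two edges), and \<open>EF \<Sigma> i\<close> is the incidence of \<open>\<Sigma>\<close> with the \<open>i\<close>-th edge of its
  boundary walk.
\<close>

datatype ('a, 'e) incidence = VE 'e bool | EF "'a set" nat

fun hasse_ends ::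
  "('a, 'e, 'm) cell_decomposition_scheme \<Rightarrow> ('a, 'e) incidence \<Rightarrow> ('a, 'e) cell set" where
  "hasse_ends K (VE e b) = {VCell (edge_end K e b), ECell e}"
| "hasse_ends K (EF \<Sigma> i) = {ECell (fst (walk K \<Sigma> ! i)), FCell \<Sigma>}"

definition hasse_edges ::
  "'a topology \<Rightarrow> ('a, 'e, 'm) cell_decomposition_scheme \<Rightarrow> ('a, 'e) incidence set" where
  "hasse_edges S K =
     {VE e b |e b. e \<in> edges K} \<union> {EF \<Sigma> i |\<Sigma> i. \<Sigma> \<in> faces S K \<and> i < length (walk K \<Sigma>)}"

definition hasse_edges_V ::
  "'a topology \<Rightarrow> ('a, 'e, 'm) cell_decomposition_scheme \<Rightarrow> ('a, 'e) incidence set" where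
  "hasse_edges_V S K = {a \<in> hasse_edges S K. \<exists>v e. hasse_ends K a = {VCell v, ECell e}}"

text \<open>
  A closed cycle is given by its distinct cells and its distinct edges in cyclic order, the
  \<open>i\<close>-th edge joining the \<open>i\<close>-th cell to the next one. Two parallel edges form a closed cycle.
\<close>

definition closed_cycle ::
  "('a, 'e, 'm) cell_decomposition_scheme \<Rightarrow> ('a, 'e) incidence set \<Rightarrow>
   ('a, 'e) cell list \<Rightarrow> ('a, 'e) incidence list \<Rightarrow> bool" where
  "closed_cycle K A cs as \<longleftrightarrow>
     length cs = length as \<and> 2 \<le> length as \<and> distinct cs \<and> distinct as \<and> set as \<subseteq> A \<and>
     (\<forall>i<length as. hasse_ends K (as ! i) = {cs ! i, cs ! (Suc i mod length as)})"

definition alternate_edges :: "'i list \<Rightarrow> 'i set" where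
  "alternate_edges as = {as ! i |i. i < length as \<and> even i}"

definition morse_matching_V ::
  "'a topology \<Rightarrow> ('a, 'e, 'm) cell_decomposition_scheme \<Rightarrow> ('a, 'e) incidence set \<Rightarrow> bool" where
  "morse_matching_V S K M \<longleftrightarrow>
     M \<subseteq> hasse_edges_V S K \<and>
     pairwise (\<lambda>a b. disjnt (hasse_ends K a) (hasse_ends K b)) M \<and>
     (\<nexists>cs as. closed_cycle K (hasse_edges_V S K) cs as \<and> alternate_edges as \<subseteq> M)"

definition discrete_gradient_line_field ::
  "'a topology \<Rightarrow> ('a, 'e, 'm) cell_decomposition_scheme \<Rightarrow> ('a, 'e) incidence set \<Rightarrow> bool" where
  "discrete_gradient_line_field S K M \<longleftrightarrow> decomposition S K \<and> morse_matching_V S K M"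


section \<open>Indices\<close>

definition unmatched ::
  "('a, 'e, 'm) cell_decomposition_scheme \<Rightarrow> ('a, 'e) incidence set \<Rightarrow> ('a, 'e) cell \<Rightarrow> bool" where
  "unmatched K M c \<longleftrightarrow> (\<forall>a\<in>M. c \<notin> hasse_ends K a)"

definition vertex_index ::
  "('a, 'e, 'm) cell_decomposition_scheme \<Rightarrow> ('a, 'e) incidence set \<Rightarrow> 'a \<Rightarrow> real" where
  "vertex_index K M v = (if unmatched K M (VCell v) then 1 else 0)"

definition unmatched_count ::
  "('a, 'e, 'm) cell_decomposition_scheme \<Rightarrow> ('a, 'e) incidence set \<Rightarrow> 'a set \<Rightarrow> nat" where
  "unmatched_count K M \<Sigma> = length (filter (\<lambda>d. unmatched K M (ECell (fst d))) (walk K \<Sigma>))"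

definition face_index ::
  "('a, 'e, 'm) cell_decomposition_scheme \<Rightarrow> ('a, 'e) incidence set \<Rightarrow> 'a set \<Rightarrow> real" where
  "face_index K M \<Sigma> = 1 - real (unmatched_count K M \<Sigma>) / 2"

end

theory Submission
  imports Defs "HOL-Analysis.Analysis"
begin

text \<open>
  Matched vertices and matched edges are both in bijection with the matching, and every edge
  occurs twice in the boundary walks, so the sum of the indices is \<open>V - E + F\<close>. That this number
  is the homological Euler characteristic is shown by attaching cells one at a time. If \<open>X\<close> arises from \<open>A\<close> by attaching a cell with centre \<open>p\<close>
  and interior \<open>D\<close>, then \<open>X - {p}\<close> deforms onto \<open>A\<close>, and excision identifies the homology of
  \<open>(X, X - {p})\<close> with that of \<open>(D, D - {p})\<close>. Since ranks are additive on exact sequences, the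
  Euler characteristic grows by one minus that of the boundary sphere. The same step applied
  to the circle, as a point with one edge attached, gives the value 0 needed for the faces.

  That there are only finitely many faces is not obvious for those with empty boundary walk: the
  closure of such a face is a sphere that contains a punctured neighbourhood of its only
  boundary point, so it is the whole surface.
\<close>

section \<open>Rank of abelian groups\<close>

text \<open>Gaussian elimination without division: an equation with a nonzero coefficient at
  \<open>b0\<close> is used to eliminate the unknown \<open>b0\<close> from the others. This removes
  one equation and one unknown, so unknowns stay in excess.\<close>

lemma homogeneous_int_system_nontrivial_solution:
  fixes a :: "'b \<Rightarrow> 't \<Rightarrow> int"
  assumes "finite T" "finite B" "card T < card B"
  shows "\<exists>x. (\<exists>b\<in>B. x b \<noteq> 0) \<and> (\<forall>t\<in>T. (\<Sum>b\<in>B. a b t * x b) = 0)"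
  using assms
proof (induction T arbitrary: B a rule: finite_induct)
  case empty
  then show ?case by (intro exI[of _ "\<lambda>_. 1"]) (auto simp: card_gt_0_iff)
next
  case (insert t T)
  show ?case
  proof (cases "\<forall>b\<in>B. a b t = 0")
    case True
    with insert.IH[of B a] insert.prems insert.hyps show ?thesis by auto
  next
    case False
    then obtain b0 where b0: "b0 \<in> B" "a b0 t \<noteq> 0" by auto
    define B' where "B' = B - {b0}"
    have B': "finite B'" "b0 \<notin> B'" "B = insert b0 B'" using insert.prems b0 by (auto simp: B'_def)
    then have "card T < card B'" using insert by simp
    \<comment> \<open>The new coefficients come from \<open>a b0 t\<close> times equation
      \<open>s\<close> minus \<open>a b0 s\<close> times equation \<open>t\<close>; the coefficient
      at \<open>b0\<close> cancels.\<close>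
    from insert.IH[OF \<open>finite B'\<close> this, of "\<lambda>b s. a b0 t * a b s - a b t * a b0 s"]
    obtain y where y: "\<exists>b\<in>B'. y b \<noteq> 0"
      "\<And>s. s \<in> T \<Longrightarrow> (\<Sum>b\<in>B'. (a b0 t * a b s - a b t * a b0 s) * y b) = 0" by blast
    \<comment> \<open>Back substitution: solving equation \<open>t\<close> for the unknown
      \<open>b0\<close> would require division by \<open>a b0 t\<close>, so the whole solution is
      multiplied by this factor instead.\<close>
    define x where "x b = (if b = b0 then - (\<Sum>b\<in>B'. a b t * y b) else a b0 t * y b)" for b
    have split: "(\<Sum>b\<in>B. a b s * x b)
        = a b0 s * - (\<Sum>b\<in>B'. a b t * y b) + (\<Sum>b\<in>B'. a b s * (a b0 t * y b))" for s
    proof -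
      have "(\<Sum>b\<in>B'. a b s * x b) = (\<Sum>b\<in>B'. a b s * (a b0 t * y b))"
        using B' by (intro sum.cong) (auto simp: x_def)
      then show ?thesis using B' by (simp add: x_def)
    qed
    have "(\<Sum>b\<in>B. a b s * x b) = 0" if "s \<in> insert t T" for s
    proof (cases "s = t")
      case True
      then show ?thesis by (simp add: split sum_distrib_left mult.assoc mult.left_commute)
    next
      case False
      with y(2)[of s] that show ?thesis
        by (simp add: split left_diff_distrib sum_subtractf sum_distrib_left mult.assoc mult.left_commute)
    qed
    moreover have "\<exists>b\<in>B. x b \<noteq> 0" using y(1) B' b0 by (auto simp: x_def)
    ultimately show ?thesis by blast
  qed
qed

section \<open>Integer combinations and independence in abelian groups\<close>

abbreviation int_combination :: "('g, 'm) monoid_scheme \<Rightarrow> ('g \<Rightarrow> int) \<Rightarrow> 'g set \<Rightarrow> 'g" where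
  "int_combination G c B \<equiv> finprod G (\<lambda>x. x [^]\<^bsub>G\<^esub> c x) B"

lemma int_independentD:
  "int_independent G B \<Longrightarrow> int_combination G c B = \<one>\<^bsub>G\<^esub> \<Longrightarrow> x \<in> B \<Longrightarrow> c x = 0"
  unfolding int_independent_def by blast

context comm_group
begin

lemma int_combination_closed: "T \<subseteq> carrier G \<Longrightarrow> int_combination G a T \<in> carrier G"
  by (intro finprod_closed) auto

lemma int_combination_add:
  "T \<subseteq> carrier G \<Longrightarrow>
    int_combination G (\<lambda>x. a x + b x) T = int_combination G a T \<otimes> int_combination G b T"
  by (subst finprod_multf[symmetric]) (auto intro!: finprod_cong' simp: int_pow_mult)

lemma int_combination_zero: "(\<And>x. x \<in> T \<Longrightarrow> a x = 0) \<Longrightarrow> int_combination G a T = \<one>"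
  by (intro finprod_one_eqI) simp

lemma finprod_int_pow:
  "f \<in> T \<rightarrow> carrier G \<Longrightarrow> finprod G (\<lambda>x. f x [^] (k::int)) T = finprod G f T [^] k"
proof (induction T rule: infinite_finite_induct)
  case (insert x F)
  then show ?case by (subst finprod_insert) (auto simp: Pi_iff int_pow_distrib finprod_closed)
qed auto

lemma int_combination_smult:
  "T \<subseteq> carrier G \<Longrightarrow> int_combination G (\<lambda>x. k * a x) T = int_combination G a T [^] k"
  by (subst finprod_int_pow[symmetric]) (auto intro!: finprod_cong' simp: int_pow_pow mult.commute)

lemma finprod_int_combination:
  "finite J \<Longrightarrow> T \<subseteq> carrier G \<Longrightarrow>
    finprod G (\<lambda>j. int_combination G (a j) T) J = int_combination G (\<lambda>x. \<Sum>j\<in>J. a j x) T"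
proof (induction J rule: finite_induct)
  case (insert j J)
  then show ?case
    by (subst finprod_insert) (auto simp: int_combination_add int_combination_closed)
qed (auto simp: int_combination_zero)

text \<open>The elements with a nonzero multiple in the subgroup generated by \<open>T\<close>: the preimage of
  the linear span of \<open>T\<close> in the tensor product with the rationals.\<close>

definition rational_span :: "'a set \<Rightarrow> 'a set" where
  "rational_span T =
     {x \<in> carrier G. \<exists>k::int. k \<noteq> 0 \<and> (\<exists>a. x [^] k = int_combination G a T)}"

text \<open>Some nonzero multiple \<open>k b\<close> of each \<open>b\<close> is a combination of
  \<open>T\<close>. With more elements in \<open>B\<close> than in \<open>T\<close>, the coefficient
  vectors satisfy a nontrivial relation \<open>x\<close>, and \<open>k b * x b\<close> is then a
  nontrivial relation in \<open>B\<close>.\<close>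

lemma card_independent_le_spanning:
  assumes B: "int_independent G B" "B \<subseteq> rational_span T" and T: "finite T" "T \<subseteq> carrier G"
  shows "card B \<le> card T"
proof (rule ccontr)
  assume "\<not> card B \<le> card T"
  have fB: "finite B" and BG: "B \<subseteq> carrier G" using B by (auto simp: int_independent_def)
  have "\<forall>b\<in>B. \<exists>k a. k \<noteq> (0::int) \<and> b [^] k = int_combination G a T"
    using B unfolding rational_span_def by blast
  then obtain k a where k: "\<And>b. b \<in> B \<Longrightarrow> k b \<noteq> (0::int)"
    "\<And>b. b \<in> B \<Longrightarrow> b [^] k b = int_combination G (a b) T" by metis
  from homogeneous_int_system_nontrivial_solution[OF T(1) fB, of a] \<open>\<not> card B \<le> card T\<close>
  obtain x where x: "\<exists>b\<in>B. x b \<noteq> 0" "\<And>t. t \<in> T \<Longrightarrow> (\<Sum>b\<in>B. a b t * x b) = 0" by auto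
  have "int_combination G (\<lambda>b. k b * x b) B
      = finprod G (\<lambda>b. int_combination G (\<lambda>t. x b * a b t) T) B"
  proof (intro finprod_cong')
    fix b assume b: "b \<in> B"
    then have "b [^] (k b * x b) = (b [^] k b) [^] x b" using BG by (auto simp: int_pow_pow)
    then show "b [^] (k b * x b) = int_combination G (\<lambda>t. x b * a b t) T"
      using b k(2) T by (simp add: int_combination_smult)
  qed (use T in \<open>auto intro!: finprod_closed\<close>)
  also have "\<dots> = \<one>"
    using x(2) fB T by (simp add: finprod_int_combination int_combination_zero mult.commute)
  finally have "\<forall>b\<in>B. k b * x b = 0"
    using int_independentD[OF B(1), where c = "\<lambda>b. k b * x b"] by blast
  with x(1) k(1) show False by auto
qed

lemma one_not_in_independent:
  assumes "int_independent G B" shows "\<one> \<notin> B"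
proof
  assume "\<one> \<in> B"
  have "int_combination G (\<lambda>x. if x = \<one> then 1 else 0) B = \<one>"
    using assms by (intro finprod_one_eqI) auto
  with assms \<open>\<one> \<in> B\<close> show False unfolding int_independent_def by fastforce
qed

text \<open>A relation that makes \<open>insert x B\<close> dependent has a nonzero coefficient at
  \<open>x\<close>, for otherwise it would be a relation in \<open>B\<close>. It therefore expresses
  a nonzero multiple of \<open>x\<close> by \<open>B\<close>.\<close>

lemma maximal_independent_spans:
  assumes B: "int_independent G B" and x: "x \<in> carrier G"
    and max: "x \<notin> B \<Longrightarrow> \<not> int_independent G (insert x B)"
  shows "x \<in> rational_span B"
proof -
  have fB: "finite B" and BG: "B \<subseteq> carrier G" using B by (auto simp: int_independent_def)
  show ?thesis
  proof (cases "x \<in> B")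
    case True
    have "int_combination G (\<lambda>y. if y = x then 1 else 0) B = finprod G (\<lambda>y. if x = y then y else \<one>) B"
      using BG by (intro finprod_cong') auto
    also have "\<dots> = x"
      using True fB BG finprod_singleton[of x B "\<lambda>y. y"] by auto
    finally have "x [^] (1::int) = int_combination G (\<lambda>y. if y = x then 1 else 0) B"
      using x by simp
    with x show ?thesis unfolding rational_span_def
      by (intro CollectI conjI exI[of _ "1::int"] exI) auto
  next
    case False
    from max[OF False] obtain c where c: "int_combination G c (insert x B) = \<one>"
      "\<exists>y\<in>insert x B. c y \<noteq> 0"
      unfolding int_independent_def using fB BG x by auto
    have eq: "x [^] c x \<otimes> int_combination G c B = \<one>"
      using c(1) False fB BG x by (subst (asm) finprod_insert) auto
    have "c x \<noteq> 0"
    proof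
      assume "c x = 0"
      with eq x BG have "int_combination G c B = \<one>" by (simp add: int_combination_closed)
      with B have "\<forall>y\<in>B. c y = 0" unfolding int_independent_def by blast
      with c(2) \<open>c x = 0\<close> show False by auto
    qed
    moreover have "x [^] (- c x) = int_combination G c B"
      using eq x BG by (metis int_pow_neg int_pow_closed inv_equality inv_inv int_combination_closed)
    ultimately show ?thesis using x unfolding rational_span_def
      by (intro CollectI conjI exI[of _ "- c x"]) auto
  qed
qed

end

text \<open>The rank is taken of a subset inside the ambient group, so kernels and images have ranks
  without being made into groups of their own. As a relation it also records that the cardinalities
  are bounded, which the \<open>Sup\<close> in \<open>abelian_rank\<close> does not.\<close>

definition has_rank :: "('g, 'm) monoid_scheme \<Rightarrow> 'g set \<Rightarrow> nat \<Rightarrow> bool" where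
  "has_rank G S n \<longleftrightarrow>
     (\<exists>B\<subseteq>S. int_independent G B \<and> card B = n) \<and>
     (\<forall>B\<subseteq>S. int_independent G B \<longrightarrow> card B \<le> n)"

lemma has_rank_card_le: "has_rank G S n \<Longrightarrow> B \<subseteq> S \<Longrightarrow> int_independent G B \<Longrightarrow> card B \<le> n"
  by (simp add: has_rank_def)

lemma has_rank_unique: "has_rank G S m \<Longrightarrow> has_rank G S n \<Longrightarrow> m = n"
  unfolding has_rank_def by (metis le_antisym)

lemma abelian_rank_eqI:
  assumes "has_rank G (carrier G) n" shows "abelian_rank G = n"
proof -
  let ?R = "card ` {B. int_independent G B}"
  have "n \<in> ?R" "\<And>m. m \<in> ?R \<Longrightarrow> m \<le> n"
    using assms by (auto simp: has_rank_def int_independent_def)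
  then show ?thesis unfolding abelian_rank_def by (intro cSup_eq_maximum) auto
qed

lemma int_independent_empty: "int_independent G {}"
  by (simp add: int_independent_def)

lemma has_rank_exists:
  assumes "\<And>B. B \<subseteq> S \<Longrightarrow> int_independent G B \<Longrightarrow> card B \<le> n"
  shows "\<exists>m\<le>n. has_rank G S m"
proof -
  let ?P = "\<lambda>k. \<exists>B\<subseteq>S. int_independent G B \<and> card B = k"
  have "?P 0" using int_independent_empty[of G] by (intro exI[of _ "{}"]) auto
  have le: "\<And>k. ?P k \<Longrightarrow> k \<le> n" using assms by auto
  define m where "m = Greatest ?P"
  have P: "?P m" unfolding m_def by (rule GreatestI_nat[of ?P 0 n]) (use \<open>?P 0\<close> le in auto)
  have "k \<le> m" if "?P k" for k
    unfolding m_def by (rule Greatest_le_nat[of ?P k n]) (use that le in auto)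
  then have "\<forall>B\<subseteq>S. int_independent G B \<longrightarrow> card B \<le> m" by blast
  with P le[OF P] show ?thesis by (auto simp: has_rank_def)
qed

lemma has_rank_subset:
  assumes "has_rank G S n" "T \<subseteq> S" shows "\<exists>m\<le>n. has_rank G T m"
  by (rule has_rank_exists) (use assms in \<open>auto simp: has_rank_def\<close>)

lemma (in comm_group) has_rank_one: "has_rank G {\<one>} 0"
proof -
  have "B = {}" if "B \<subseteq> {\<one>}" "int_independent G B" for B
    using that one_not_in_independent by auto
  then have "card B \<le> 0" if "B \<subseteq> {\<one>}" "int_independent G B" for B
    using that by (metis card.empty order_refl)
  from has_rank_exists[OF this] show ?thesis by auto
qed

section \<open>Ranks under homomorphisms\<close>

lemma hom_finprod:
  assumes "comm_group G" "comm_group H" "h \<in> hom G H" "f \<in> A \<rightarrow> carrier G"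
  shows "h (finprod G f A) = finprod H (\<lambda>x. h (f x)) A"
proof -
  interpret G: comm_group G by fact
  interpret H: comm_group H by fact
  interpret group_hom G H h by unfold_locales fact
  show ?thesis using assms(4)
  proof (induction A rule: infinite_finite_induct)
    case (insert x F)
    then show ?case
      by (subst G.finprod_insert, simp_all, subst H.finprod_insert)
        (auto simp: Pi_iff G.finprod_closed)
  qed auto
qed

lemma hom_int_combination:
  assumes "comm_group G" "comm_group H" "h \<in> hom G H" "B \<subseteq> carrier G"
  shows "h (int_combination G c B) = finprod H (\<lambda>x. h x [^]\<^bsub>H\<^esub> c x) B"
proof -
  interpret G: comm_group G by fact
  interpret H: comm_group H by fact
  interpret group_hom G H h by unfold_locales fact
  show ?thesis using assms
    by (subst hom_finprod[OF assms(1-3)]) (auto intro!: H.finprod_cong' simp: hom_int_pow)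
qed

lemma hom_int_combination_section:
  assumes "comm_group G" "comm_group H" "h \<in> hom G H" "C \<subseteq> carrier H"
    and "g \<in> C \<rightarrow> carrier G" "\<And>y. y \<in> C \<Longrightarrow> h (g y) = y"
  shows "h (int_combination G c (g ` C)) = int_combination H (c \<circ> g) C"
proof -
  interpret G: comm_group G by fact
  interpret H: comm_group H by fact
  interpret group_hom G H h by unfold_locales fact
  have "inj_on g C" by (metis assms(6) inj_onI)
  then have "finprod H (\<lambda>x. h x [^]\<^bsub>H\<^esub> c x) (g ` C) = finprod H (\<lambda>y. h (g y) [^]\<^bsub>H\<^esub> c (g y)) C"
    using assms by (subst H.finprod_reindex) auto
  also have "\<dots> = int_combination H (c \<circ> g) C"
    using assms by (intro H.finprod_cong') auto
  finally show ?thesis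
    using assms by (subst hom_int_combination[OF assms(1-3)]) auto
qed

text \<open>The homomorphism sends a relation among the lifts to a relation in \<open>C\<close> with
  the same coefficients, which must all vanish.\<close>

lemma independent_section:
  assumes "comm_group G" "comm_group H" "h \<in> hom G H" "int_independent H C"
    and "g \<in> C \<rightarrow> carrier G" "\<And>y. y \<in> C \<Longrightarrow> h (g y) = y"
  shows "int_independent G (g ` C)"
proof -
  interpret G: comm_group G by fact
  interpret H: comm_group H by fact
  interpret group_hom G H h by unfold_locales fact
  have C: "finite C" "C \<subseteq> carrier H" using assms(4) by (auto simp: int_independent_def)
  have "c x = 0" if "int_combination G c (g ` C) = \<one>\<^bsub>G\<^esub>" "x \<in> g ` C" for c x
  proof -
    have "int_combination H (c \<circ> g) C = \<one>\<^bsub>H\<^esub>"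
      using that(1) hom_int_combination_section[OF assms(1-3) C(2) assms(5,6), of c] by simp
    then have "\<forall>y\<in>C. (c \<circ> g) y = 0" using assms(4) unfolding int_independent_def by blast
    with that show ?thesis by auto
  qed
  then show ?thesis using C assms(5) unfolding int_independent_def by blast
qed

lemma has_rank_image:
  assumes "comm_group G" "comm_group H" "h \<in> hom G H" "has_rank G (carrier G) n"
  shows "\<exists>m\<le>n. has_rank H (h ` carrier G) m"
proof (rule has_rank_exists)
  fix C assume C: "C \<subseteq> h ` carrier G" "int_independent H C"
  define g where "g = inv_into (carrier G) h"
  have g: "g \<in> C \<rightarrow> carrier G" "\<And>y. y \<in> C \<Longrightarrow> h (g y) = y"
    using C by (auto simp: g_def inv_into_into f_inv_into_f subset_iff)
  have "int_independent G (g ` C)" by (rule independent_section[OF assms(1-3) C(2) g])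
  then have "card (g ` C) \<le> n" using g by (intro has_rank_card_le[OF assms(4)]) auto
  moreover have "card (g ` C) = card C" by (intro card_image) (metis g(2) inj_onI)
  ultimately show "card C \<le> n" by simp
qed

text \<open>A maximal independent set \<open>A\<close> in the kernel together with lifts of a
  maximal independent set \<open>C\<close> in the image is independent and spans rationally. For
  independence, \<open>h\<close> kills the part in \<open>A\<close>. For spanning, some multiple of
  \<open>x\<close> differs from a combination of the lifts by an element \<open>z\<close> of the
  kernel, and some multiple of \<open>z\<close> is a combination of \<open>A\<close>.\<close>

lemma rank_nullity:
  assumes "comm_group G" "comm_group H" "h \<in> hom G H"
    and ker: "has_rank G (kernel G H h) k" and im: "has_rank H (h ` carrier G) m"
  shows "has_rank G (carrier G) (k + m)"
proof -
  interpret G: comm_group G by fact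
  interpret H: comm_group H by fact
  interpret h: group_hom G H h by unfold_locales fact
  from ker obtain A where A: "A \<subseteq> kernel G H h" "int_independent G A" "card A = k"
    unfolding has_rank_def by blast
  from im obtain C where C: "C \<subseteq> h ` carrier G" "int_independent H C" "card C = m"
    unfolding has_rank_def by blast
  define g where "g = inv_into (carrier G) h"
  have g: "g \<in> C \<rightarrow> carrier G" "\<And>y. y \<in> C \<Longrightarrow> h (g y) = y"
    using C by (auto simp: g_def inv_into_into f_inv_into_f subset_iff)
  have fin: "finite A" "finite C" and CH: "C \<subseteq> carrier H" and AG: "A \<subseteq> carrier G"
    using A C by (auto simp: int_independent_def)
  let ?T = "A \<union> g ` C"
  have TG: "finite ?T" "?T \<subseteq> carrier G" using fin AG g by auto
  have hA: "h a = \<one>\<^bsub>H\<^esub>" if "a \<in> A" for a using A that by (auto simp: kernel_def)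
  \<comment> \<open>Elements of \<open>A\<close> are mapped to the neutral element, which no
    independent set contains; a lift is mapped into \<open>C\<close>.\<close>
  have disj: "A \<inter> g ` C = {}"
  proof -
    have "g y \<notin> A" if "y \<in> C" for y
      using hA[of "g y"] g(2)[OF that] that H.one_not_in_independent[OF C(2)] by auto
    then show ?thesis by auto
  qed
  have cardT: "card ?T = k + m"
    using fin disj A C card_image[of g C] g(2) by (subst card_Un_disjoint) (auto intro: inj_onI, metis inj_onI)
  have split: "int_combination G c ?T = int_combination G c A \<otimes>\<^bsub>G\<^esub> int_combination G c (g ` C)" for c
    using fin disj AG g by (intro G.finprod_Un_disjoint) auto
  have gC: "int_independent G (g ` C)"
    by (rule independent_section[OF assms(1-3) C(2) g])
  have "int_independent G ?T"
    unfolding int_independent_def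
  proof (intro conjI allI impI)
    fix c assume c: "int_combination G c ?T = \<one>\<^bsub>G\<^esub>"
    have "h (int_combination G c A) = \<one>\<^bsub>H\<^esub>"
      using AG hA by (subst hom_int_combination[OF assms(1-3)]) (auto intro!: H.finprod_one_eqI)
    moreover have "h (int_combination G c (g ` C)) = int_combination H (c \<circ> g) C"
      by (rule hom_int_combination_section[OF assms(1-3) CH g])
    moreover have "h (int_combination G c ?T) = \<one>\<^bsub>H\<^esub>" using c by simp
    moreover have cl: "int_combination G c A \<in> carrier G" "int_combination G c (g ` C) \<in> carrier G"
        "int_combination H (c \<circ> g) C \<in> carrier H"
      using G.int_combination_closed[of A c] G.int_combination_closed[of "g ` C" c]
        H.int_combination_closed[OF CH, of "c \<circ> g"] TG by auto
    ultimately have "int_combination H (c \<circ> g) C = \<one>\<^bsub>H\<^esub>"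
      by (simp add: split)
    then have "\<forall>y\<in>C. (c \<circ> g) y = 0" using C(2) unfolding int_independent_def by blast
    then have c0: "\<forall>x\<in>g ` C. c x = 0" by auto
    then have "int_combination G c (g ` C) = \<one>\<^bsub>G\<^esub>" by (intro G.int_combination_zero) auto
    then have "int_combination G c A = \<one>\<^bsub>G\<^esub>" using c cl by (simp add: split)
    then have "\<forall>x\<in>A. c x = 0" using A(2) unfolding int_independent_def by blast
    with c0 show "\<forall>x\<in>?T. c x = 0" by auto
  qed (use TG in auto)
  moreover have "x \<in> G.rational_span ?T" if x: "x \<in> carrier G" for x
  proof -
    have "h x \<in> H.rational_span C"
    proof (rule H.maximal_independent_spans[OF C(2)])
      assume "h x \<notin> C"
      show "\<not> int_independent H (insert (h x) C)"
      proof
        assume "int_independent H (insert (h x) C)"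
        then have "card (insert (h x) C) \<le> m"
          using C(1) x by (intro has_rank_card_le[OF im]) auto
        with \<open>h x \<notin> C\<close> fin C show False by simp
      qed
    qed (use x in auto)
    then obtain l b where l: "l \<noteq> (0::int)" "h x [^]\<^bsub>H\<^esub> l = int_combination H b C"
      unfolding H.rational_span_def by auto
    \<comment> \<open>The sign makes the combination of lifts cancel the image of the
      \<open>l\<close>-th power of \<open>x\<close>, so that their product \<open>z\<close> lies in
      the kernel.\<close>
    let ?b = "\<lambda>x. - b (h x)"
    have "h (int_combination G ?b (g ` C)) = int_combination H (?b \<circ> g) C"
      by (rule hom_int_combination_section[OF assms(1-3) CH g])
    also have "\<dots> = int_combination H (\<lambda>x. -1 * b x) C"
      using g CH by (intro H.finprod_cong') auto
    also have "\<dots> = inv\<^bsub>H\<^esub> (int_combination H b C)"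
      using H.int_combination_smult[OF CH, of "-1" b] H.int_combination_closed[OF CH, of b]
        H.int_pow_neg[of "int_combination H b C" 1] by simp
    finally have hb: "h (int_combination G ?b (g ` C)) = inv\<^bsub>H\<^esub> (h x [^]\<^bsub>H\<^esub> l)" using l by simp
    have bcl: "int_combination G ?b (g ` C) \<in> carrier G"
      by (rule G.int_combination_closed) (use g in auto)
    define z where "z = x [^]\<^bsub>G\<^esub> l \<otimes>\<^bsub>G\<^esub> int_combination G ?b (g ` C)"
    have zG: "z \<in> carrier G" using x bcl by (auto simp: z_def)
    have "h z = \<one>\<^bsub>H\<^esub>" using x bcl hb by (simp add: z_def h.hom_int_pow)
    then have zk: "z \<in> kernel G H h" using zG by (auto simp: kernel_def)
    have "z \<in> G.rational_span A"
    proof (rule G.maximal_independent_spans[OF A(2) zG])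
      assume "z \<notin> A"
      show "\<not> int_independent G (insert z A)"
      proof
        assume "int_independent G (insert z A)"
        then have "card (insert z A) \<le> k"
          using A(1) zk by (intro has_rank_card_le[OF ker]) auto
        with \<open>z \<notin> A\<close> fin A show False by simp
      qed
    qed
    then obtain j a where j: "j \<noteq> (0::int)" "z [^]\<^bsub>G\<^esub> j = int_combination G a A"
      unfolding G.rational_span_def by auto
    define d where "d y = (if y \<in> A then a y else j * - ?b y)" for y
    have "int_combination G d A = z [^]\<^bsub>G\<^esub> j"
      unfolding j(2) using AG by (intro G.finprod_cong') (auto simp: d_def)
    moreover have "int_combination G d (g ` C) = int_combination G (\<lambda>y. (- j) * ?b y) (g ` C)"
      using disj g by (intro G.finprod_cong') (auto simp: d_def)
    moreover have "\<dots> = int_combination G ?b (g ` C) [^]\<^bsub>G\<^esub> (- j)"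
      using g by (intro G.int_combination_smult) auto
    ultimately have "int_combination G d ?T
        = z [^]\<^bsub>G\<^esub> j \<otimes>\<^bsub>G\<^esub> int_combination G ?b (g ` C) [^]\<^bsub>G\<^esub> (- j)"
      by (simp add: split)
    also have "\<dots> = x [^]\<^bsub>G\<^esub> (l * j)"
      using x bcl by (simp add: z_def G.int_pow_distrib G.int_pow_pow G.int_pow_neg G.m_assoc)
    finally show ?thesis using x l j unfolding G.rational_span_def
      by (intro CollectI conjI exI[of _ "l * j"] exI[of _ d]) auto
  qed
  then have "card B \<le> k + m" if "int_independent G B" "B \<subseteq> carrier G" for B
    using G.card_independent_le_spanning[OF that(1) _ TG] that(2) cardT by auto
  ultimately show ?thesis unfolding has_rank_def using TG cardT
    by (intro conjI exI[of _ ?T]) auto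
qed

lemma rank_nullity_exists:
  assumes "comm_group G" "comm_group H" "h \<in> hom G H" "has_rank G (carrier G) n"
  shows "\<exists>k m. has_rank G (kernel G H h) k \<and> has_rank H (h ` carrier G) m \<and> n = k + m"
proof -
  obtain m where "has_rank H (h ` carrier G) m" using has_rank_image[OF assms] by auto
  moreover obtain k where "has_rank G (kernel G H h) k"
    using has_rank_subset[OF assms(4), of "kernel G H h"] by (auto simp: kernel_def)
  ultimately show ?thesis using rank_nullity[OF assms(1-3)] has_rank_unique[OF assms(4)] by blast
qed

lemma has_rank_iso:
  assumes "comm_group G" "comm_group H" "G \<cong> H" "has_rank G (carrier G) n"
  shows "has_rank H (carrier H) n"
proof -
  interpret G: comm_group G by fact
  interpret H: comm_group H by fact
  obtain h where h: "h \<in> iso G H" using assms by (auto simp: is_iso_def)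
  then have hom: "h \<in> hom G H" and "h ` carrier G = carrier H" "inj_on h (carrier G)"
    by (auto simp: iso_def bij_betw_def)
  interpret group_hom G H h by unfold_locales fact
  have "kernel G H h = {\<one>\<^bsub>G\<^esub>}" using inj_iff_trivial_ker \<open>inj_on h _\<close> by blast
  with rank_nullity_exists[OF assms(1,2) hom assms(4)] G.has_rank_one \<open>h ` _ = _\<close>
  show ?thesis by (metis add_0 has_rank_unique)
qed

section \<open>Euler characteristic of pairs\<close>

text \<open>A relation instead of a function, so that the finiteness of the ranks and the vanishing of
  almost all of them is part of every statement.\<close>

definition graded_euler :: "(int \<Rightarrow> ('g, 'm) monoid_scheme) \<Rightarrow> int \<Rightarrow> bool" where
  "graded_euler G c \<longleftrightarrow>
     (\<exists>r F. (\<forall>p. has_rank (G p) (carrier (G p)) (r p)) \<and> finite F \<and> (\<forall>p. p \<notin> F \<longrightarrow> r p = 0) \<and>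
        c = (\<Sum>p\<in>F. (if even p then 1 else -1) * int (r p)))"

lemma graded_eulerE:
  assumes "graded_euler G c"
  obtains r F where "\<And>p. has_rank (G p) (carrier (G p)) (r p)" "finite F"
    "\<And>p. p \<notin> F \<Longrightarrow> r p = 0" "c = (\<Sum>p\<in>F. (if even p then 1 else -1) * int (r p))"
  using assms unfolding graded_euler_def by auto

lemma graded_euler_iso:
  assumes "graded_euler G c" "\<And>p. comm_group (G p)" "\<And>p. comm_group (H p)" "\<And>p. G p \<cong> H p"
  shows "graded_euler H c"
proof -
  obtain r F where "\<forall>p. has_rank (G p) (carrier (G p)) (r p)" "finite F" "\<forall>p. p \<notin> F \<longrightarrow> r p = 0"
    "c = (\<Sum>p\<in>F. (if even p then 1 else -1) * int (r p))"
    using graded_eulerE[OF assms(1)] by blast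
  moreover have "\<forall>p. has_rank (H p) (carrier (H p)) (r p)"
    using has_rank_iso[OF assms(2-4)] calculation(1) by blast
  ultimately show ?thesis unfolding graded_euler_def by blast
qed

lemma graded_euler_shift:
  assumes "graded_euler G c" shows "graded_euler (\<lambda>p. G (p - 1)) (- c)"
proof -
  obtain r F where r: "\<forall>p. has_rank (G p) (carrier (G p)) (r p)" "finite F" "\<forall>p. p \<notin> F \<longrightarrow> r p = 0"
    "c = (\<Sum>p\<in>F. (if even p then 1 else -1) * int (r p))"
    using graded_eulerE[OF assms(1)] by blast
  have "(\<Sum>p\<in>(\<lambda>p. p + 1) ` F. (if even p then 1 else -1) * int (r (p - 1))) = - c"
    unfolding r(4) by (subst sum.reindex) (auto simp: sum_negf[symmetric] intro!: sum.cong)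
  moreover have "\<forall>p. p \<notin> (\<lambda>p. p + 1) ` F \<longrightarrow> r (p - 1) = 0"
    using r(3) by (metis diff_add_cancel image_eqI)
  ultimately show ?thesis using r(1,2) unfolding graded_euler_def
    by (intro exI[of _ "\<lambda>p. r (p - 1)"] exI[of _ "(\<lambda>p. p + 1) ` F"]) auto
qed

text \<open>By rank-nullity each rank in the long exact sequence is the sum of the ranks of two
  neighbouring images. With \<open>k\<close> and \<open>m\<close> for the kernel and image of
  \<open>i\<close>, and \<open>l\<close> and \<open>n\<close> for those of \<open>d\<close>,
  exactness gives \<open>n p = k (p - 1)\<close> and rank \<open>m p + l p\<close> for
  \<open>B p\<close>. In the alternating sum the terms \<open>k p\<close> and
  \<open>k (p - 1)\<close> cancel after an index shift.\<close>

lemma graded_euler_exact: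
  assumes A: "\<And>p. comm_group (A p)" and B: "\<And>p. comm_group (B p)" and C: "\<And>p. comm_group (C p)"
    and i: "\<And>p. i p \<in> hom (A p) (B p)" and j: "\<And>p. j p \<in> hom (B p) (C p)"
    and d: "\<And>p. d p \<in> hom (C p) (A (p - 1))"
    and exB: "\<And>p. i p ` carrier (A p) = kernel (B p) (C p) (j p)"
    and exC: "\<And>p. j p ` carrier (B p) = kernel (C p) (A (p - 1)) (d p)"
    and exA: "\<And>p. d p ` carrier (C p) = kernel (A (p - 1)) (B (p - 1)) (i (p - 1))"
    and eA: "graded_euler A a" and eC: "graded_euler C c"
  shows "graded_euler B (a + c)"
proof -
  let ?s = "\<lambda>p::int. if even p then 1 else -1 :: int"
  obtain r F where r: "\<And>p. has_rank (A p) (carrier (A p)) (r p)" "finite F" "\<And>p. p \<notin> F \<Longrightarrow> r p = 0"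
    "a = (\<Sum>p\<in>F. ?s p * int (r p))"
    using graded_eulerE[OF eA] by metis
  obtain s E where s: "\<And>p. has_rank (C p) (carrier (C p)) (s p)" "finite E" "\<And>p. p \<notin> E \<Longrightarrow> s p = 0"
    "c = (\<Sum>p\<in>E. ?s p * int (s p))"
    using graded_eulerE[OF eC] by metis
  obtain k m where km: "\<And>p. has_rank (A p) (kernel (A p) (B p) (i p)) (k p)"
    "\<And>p. has_rank (B p) (i p ` carrier (A p)) (m p)" "\<And>p. r p = k p + m p"
    using rank_nullity_exists[OF A B i r(1)] by metis
  obtain l n where ln: "\<And>p. has_rank (C p) (kernel (C p) (A (p - 1)) (d p)) (l p)"
    "\<And>p. has_rank (A (p - 1)) (d p ` carrier (C p)) (n p)" "\<And>p. s p = l p + n p"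
    using rank_nullity_exists[OF C A d s(1)] by metis
  have n: "n p = k (p - 1)" for p
    using ln(2)[of p] km(1)[of "p - 1"] has_rank_unique unfolding exA by blast
  have B_rank: "has_rank (B p) (carrier (B p)) (m p + l p)" for p
    using rank_nullity[OF B C j] km(2) ln(1) exB exC by metis
  \<comment> \<open>The translate of \<open>F\<close> is included because \<open>k (p - 1)\<close>
    may be nonzero for \<open>p - 1\<close> in \<open>F\<close>.\<close>
  define F' where "F' = F \<union> E \<union> (\<lambda>p. p + 1) ` F"
  have F': "finite F'" "F \<subseteq> F'" "E \<subseteq> F'" using r s by (auto simp: F'_def)
  have k0: "k p = 0" "m p = 0" if "p \<notin> F" for p using r(3)[OF that] km(3)[of p] by auto
  have l0: "l p = 0" if "p \<notin> E" for p using s(3)[OF that] ln(3)[of p] by auto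
  have a: "a = (\<Sum>p\<in>F'. ?s p * int (r p))"
    unfolding r(4) by (rule sum.mono_neutral_left) (use F' r in auto)
  have c: "c = (\<Sum>p\<in>F'. ?s p * int (s p))"
    unfolding s(4) by (rule sum.mono_neutral_left) (use F' s in auto)
  have shift: "(\<Sum>p\<in>F'. ?s p * int (k (p - 1))) = - (\<Sum>p\<in>F'. ?s p * int (k p))"
  proof -
    have "(\<Sum>p\<in>F'. ?s p * int (k (p - 1))) = (\<Sum>p\<in>(\<lambda>p. p + 1) ` F. ?s p * int (k (p - 1)))"
    proof (rule sum.mono_neutral_right)
      show "\<forall>p\<in>F' - (\<lambda>p. p + 1) ` F. ?s p * int (k (p - 1)) = 0"
      proof
        fix p assume "p \<in> F' - (\<lambda>p. p + 1) ` F"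
        then have "p - 1 \<notin> F" by (metis DiffD2 diff_add_cancel image_eqI)
        then show "?s p * int (k (p - 1)) = 0" using k0 by simp
      qed
    qed (use F' in \<open>auto simp: F'_def\<close>)
    also have "\<dots> = (\<Sum>p\<in>F. - (?s p * int (k p)))"
      by (subst sum.reindex) (auto intro!: sum.cong)
    also have "\<dots> = - (\<Sum>p\<in>F'. ?s p * int (k p))"
      unfolding sum_negf by (subst sum.mono_neutral_left[of F' F]) (use F' k0 in auto)
    finally show ?thesis .
  qed
  have "(\<Sum>p\<in>F'. ?s p * int (m p + l p))
      = (\<Sum>p\<in>F'. ?s p * int (r p) + ?s p * int (s p) - (?s p * int (k p) + ?s p * int (k (p - 1))))"
    by (intro sum.cong) (auto simp: km(3) ln(3) n)
  also have "\<dots> = a + c"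
    using shift by (simp only: sum.distrib sum_subtractf a c)
  finally have "(\<Sum>p\<in>F'. ?s p * int (m p + l p)) = a + c" .
  moreover have "m p + l p = 0" if "p \<notin> F'" for p using that F' k0 l0 by blast
  ultimately show ?thesis
    using B_rank F' unfolding graded_euler_def
    by (intro exI[of _ "\<lambda>p. m p + l p"] exI[of _ F']) auto
qed

definition has_euler :: "'a topology \<Rightarrow> 'a set \<Rightarrow> int \<Rightarrow> bool" where
  "has_euler X S c \<longleftrightarrow> graded_euler (\<lambda>p. relative_homology_group p X S) c"

lemma has_rank_trivial_group:
  assumes "comm_group G" "trivial_group G" shows "has_rank G (carrier G) 0"
  using comm_group.has_rank_one[OF assms(1)] assms(2) by (simp add: trivial_group_def)

lemma euler_characteristic_eqI:
  assumes "has_euler X {} c" shows "euler_characteristic X = c"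
proof -
  obtain r F where r: "\<And>p. has_rank (homology_group p X) (carrier (homology_group p X)) (r p)"
    "finite F" "\<And>p. p \<notin> F \<Longrightarrow> r p = 0" "c = (\<Sum>p\<in>F. (if even p then 1 else -1) * int (r p))"
    using assms unfolding has_euler_def by (rule graded_eulerE) blast
  have betti: "betti p X = r p" for p
    unfolding betti_def by (rule abelian_rank_eqI[OF r(1)])
  \<comment> \<open>In negative degrees \<open>nat p\<close> is 0, and the power in the definition
    would lose the parity of \<open>p\<close>; only the vanishing of homology there lets the two
    sign conventions agree.\<close>
  have neg: "p \<ge> 0" if "r p \<noteq> 0" for p
  proof (rule ccontr)
    assume "\<not> p \<ge> 0"
    then have "trivial_group (homology_group p X)" by simp
    from has_rank_unique[OF r(1) has_rank_trivial_group[OF abelian_homology_group this]] that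
    show False by simp
  qed
  have sgn: "(- 1) ^ nat p = (if even p then 1 else -1 :: int)" if "p \<ge> 0" for p
    using that by (metis even_of_nat int_nat_eq neg_one_even_power neg_one_odd_power)
  have "euler_characteristic X = (\<Sum>p | r p \<noteq> 0. (if even p then 1 else -1) * int (r p))"
    unfolding euler_characteristic_def betti using neg sgn by (intro sum.cong) auto
  also have "\<dots> = c"
    unfolding r(4)
  proof (rule sum.mono_neutral_left[OF r(2)])
    show "{p. r p \<noteq> 0} \<subseteq> F" by (rule subsetI, rule ccontr) (simp add: r(3))
  qed simp
  finally show ?thesis .
qed

lemma has_euler_cong:
  assumes "has_euler X S c" "\<And>p. relative_homology_group p X S \<cong> relative_homology_group p Y T"
  shows "has_euler Y T c"
  unfolding has_euler_def
  by (rule graded_euler_iso[OF assms(1)[unfolded has_euler_def] abelian_relative_homology_group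
        abelian_relative_homology_group assms(2)])

lemma has_euler_homotopy_equivalent:
  assumes "has_euler X {} c" "X homotopy_equivalent_space Y" shows "has_euler Y {} c"
  using assms homotopy_equivalent_space_imp_isomorphic_homology_groups has_euler_cong by metis

text \<open>The long exact sequence of the pair, with the homology of \<open>X\<close> as the middle
  term.\<close>

lemma has_euler_pair:
  assumes "has_euler (subtopology X S) {} a" "has_euler X S c"
  shows "has_euler X {} (a + c)"
  unfolding has_euler_def
proof (rule graded_euler_exact[where A = "\<lambda>p. homology_group p (subtopology X S)"
      and C = "\<lambda>p. relative_homology_group p X S"
      and i = "\<lambda>p. hom_induced p (subtopology X S) {} X {} id"
      and j = "\<lambda>p. hom_induced p X {} X S id" and d = "\<lambda>p. hom_boundary p X S"])
  fix p
  show "hom_induced p (subtopology X S) {} X {} id ` carrier (homology_group p (subtopology X S))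
      = kernel (homology_group p X) (relative_homology_group p X S) (hom_induced p X {} X S id)"
    using homology_exactness_axiom_3[of p X S] by simp
  show "hom_induced p X {} X S id ` carrier (homology_group p X)
      = kernel (relative_homology_group p X S) (homology_group (p - 1) (subtopology X S)) (hom_boundary p X S)"
    using homology_exactness_axiom_1[of p X S] by simp
  show "hom_boundary p X S ` carrier (relative_homology_group p X S)
      = kernel (homology_group (p - 1) (subtopology X S)) (homology_group (p - 1) X)
          (hom_induced (p - 1) (subtopology X S) {} X {} id)"
    using homology_exactness_axiom_2[of p X S] by simp
qed (use assms in \<open>simp_all add: has_euler_def hom_induced_hom hom_boundary_hom\<close>)

text \<open>The same exact sequence rotated by one place: relative homology is now the middle term,
  and the homology of the subspace appears with its degree shifted by one, hence with the opposite
  sign.\<close>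

lemma has_euler_relative:
  assumes "has_euler (subtopology X S) {} a" "has_euler X {} b"
  shows "has_euler X S (b - a)"
proof -
  have "graded_euler (\<lambda>p. relative_homology_group p X S) (b + - a)"
  proof (rule graded_euler_exact[where A = "\<lambda>p. homology_group p X"
      and C = "\<lambda>p. homology_group (p - 1) (subtopology X S)"
      and i = "\<lambda>p. hom_induced p X {} X S id"
      and j = "\<lambda>p. hom_boundary p X S"
      and d = "\<lambda>p. hom_induced (p - 1) (subtopology X S) {} X {} id"])
    fix p
    show "hom_induced p X {} X S id ` carrier (homology_group p X)
        = kernel (relative_homology_group p X S) (homology_group (p - 1) (subtopology X S)) (hom_boundary p X S)"
      using homology_exactness_axiom_1[of p X S] by simp
    show "hom_boundary p X S ` carrier (relative_homology_group p X S)
        = kernel (homology_group (p - 1) (subtopology X S)) (homology_group (p - 1) X)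
            (hom_induced (p - 1) (subtopology X S) {} X {} id)"
      using homology_exactness_axiom_2[of p X S] by simp
    show "hom_induced (p - 1) (subtopology X S) {} X {} id ` carrier (homology_group (p - 1) (subtopology X S))
        = kernel (homology_group (p - 1) X) (relative_homology_group (p - 1) X S)
            (hom_induced (p - 1) X {} X S id)"
      using homology_exactness_axiom_3[of "p - 1" X S] by simp
    show "graded_euler (\<lambda>p. homology_group (p - 1) (subtopology X S)) (- a)"
      using assms(1) unfolding has_euler_def by (rule graded_euler_shift)
  qed (use assms in \<open>simp_all add: has_euler_def hom_induced_hom hom_boundary_hom\<close>)
  then show ?thesis by (simp add: has_euler_def)
qed

section \<open>Contractible spaces, excision and finite discrete spaces\<close>

lemma has_rank_integer_group: "has_rank integer_group (carrier integer_group) 1"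
proof -
  interpret comm_group integer_group by (rule abelian_integer_group)
  have one: "int_independent integer_group {1}"
    unfolding int_independent_def by simp
  have "x \<in> rational_span {1}" for x
    unfolding rational_span_def by (auto intro!: exI[of _ "1::int"] exI[of _ "\<lambda>_. x"])
  then have "card B \<le> card {1::int}" if "int_independent integer_group B" for B
    using that by (intro card_independent_le_spanning) auto
  with one show ?thesis unfolding has_rank_def by (intro conjI exI[of _ "{1}"]) auto
qed

lemma has_euler_singleton:
  assumes "topspace X = {a}" shows "has_euler X {} 1"
proof -
  have "has_rank (homology_group p X) (carrier (homology_group p X)) (if p = 0 then 1 else 0)" for p
  proof (cases "p = 0")
    case True
    have "integer_group \<cong> homology_group 0 X"
      using homology_coefficients[OF assms] group.iso_sym by (metis group_relative_homology_group)
    from has_rank_iso[OF abelian_integer_group abelian_homology_group this has_rank_integer_group] True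
    show ?thesis by simp
  next
    case False
    then show ?thesis
      using has_rank_trivial_group[OF abelian_homology_group homology_dimension_axiom[OF assms]] by simp
  qed
  then show ?thesis unfolding has_euler_def graded_euler_def
    by (intro exI[of _ "\<lambda>p. if p = 0 then 1 else 0"] exI[of _ "{0}"]) auto
qed

lemma has_euler_contractible:
  assumes "contractible_space X" "topspace X \<noteq> {}" shows "has_euler X {} 1"
proof -
  obtain a where "X homotopy_equivalent_space subtopology X {a}" "a \<in> topspace X"
    using assms by (auto simp: contractible_eq_homotopy_equivalent_singleton_subtopology)
  then show ?thesis
    using has_euler_homotopy_equivalent has_euler_singleton[of "subtopology X {a}" a]
      homotopy_equivalent_space_sym by (metis Int_insert_right_if1 inf_bot_right topspace_subtopology)
qed

lemma has_euler_empty: "topspace X = {} \<Longrightarrow> has_euler X {} 0"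
  unfolding has_euler_def graded_euler_def
  using has_rank_trivial_group[OF abelian_homology_group trivial_homology_group_empty[of X]]
  by (intro exI[of _ "\<lambda>_. 0"] exI[of _ "{}"]) auto

lemma has_euler_excision:
  assumes "has_euler (subtopology X (S - U)) (T - U) c"
    and "X closure_of U \<subseteq> X interior_of T" "T \<subseteq> S"
  shows "has_euler (subtopology X S) T c"
  by (rule has_euler_cong[OF assms(1)]) (use homology_excision_axiom[OF assms(2,3)] in \<open>auto simp: is_iso_def\<close>)

text \<open>As the complement of the closed set \<open>B\<close>, the closed set \<open>A\<close> is
  also open. All of \<open>A\<close> can therefore be excised from the pair of \<open>X\<close> and
  \<open>A\<close>, which leaves \<open>B\<close> relative to the empty set.\<close>

lemma has_euler_disjoint_union:
  assumes "closedin X A" "closedin X B" "A \<inter> B = {}" "A \<union> B = topspace X"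
    and "has_euler (subtopology X A) {} a" "has_euler (subtopology X B) {} b"
  shows "has_euler X {} (a + b)"
proof (rule has_euler_pair[OF assms(5)])
  have B: "topspace X - A = B" using assms(3,4) by auto
  have "A = topspace X - B" using assms(3,4) by auto
  then have "openin X A" using assms(2) by (simp add: closedin_def)
  then have "X closure_of A \<subseteq> X interior_of A"
    using assms(1) by (simp add: closure_of_closedin interior_of_openin)
  moreover have "has_euler (subtopology X (topspace X - A)) (A - A) b"
    using assms(6) B by simp
  ultimately have "has_euler (subtopology X (topspace X)) A b"
    using closedin_subset[OF assms(1)] has_euler_excision by blast
  then show "has_euler X A b" by simp
qed

lemma has_euler_finite_Hausdorff:
  assumes "Hausdorff_space X" "finite V" "V \<subseteq> topspace X"
  shows "has_euler (subtopology X V) {} (int (card V))"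
  using assms(2,3)
proof (induction V rule: finite_induct)
  case empty
  then show ?case by (simp add: has_euler_empty)
next
  case (insert v V)
  let ?Y = "subtopology X (insert v V)"
  have Y: "Hausdorff_space ?Y" "topspace ?Y = insert v V"
    using assms insert by (auto simp: Hausdorff_space_subtopology)
  have cl: "closedin ?Y A" if "A \<subseteq> insert v V" for A
    using insert that Y finite_subset[OF that] by (auto intro!: closedin_Hausdorff_finite)
  have "has_euler ?Y {} (1 + int (card V))"
  proof (rule has_euler_disjoint_union[of _ "{v}" V])
    show "has_euler (subtopology ?Y {v}) {} 1"
      by (rule has_euler_singleton[of _ v]) (use Y in auto)
    show "has_euler (subtopology ?Y V) {} (int (card V))"
      using insert by (simp add: subtopology_subtopology Int_absorb1 subset_insertI)
  qed (use insert Y cl in auto)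
  then show ?case using insert by simp
qed

section \<open>Attaching a cell\<close>

text \<open>Radial projection moves the punctured cell onto the subspace to which the cell is attached.
  Continuity on the product with the unit interval holds because a continuous map from the
  compact cylinder over the closed cell to a Hausdorff space is closed.\<close>

lemma punctured_cell_homotopy_equivalent:
  fixes h :: "'n::euclidean_space \<Rightarrow> 'a"
  assumes X: "Hausdorff_space X" and A: "closedin X A"
    and h: "continuous_map (top_of_set (cball 0 1)) X h"
    and hA: "h ` sphere 0 1 \<subseteq> A" and inj: "inj_on h (ball 0 1)"
    and im: "h ` ball 0 1 = topspace X - A"
  shows "subtopology X (topspace X - {h 0}) homotopy_equivalent_space subtopology X A"
proof -
  let ?I = "{0..1::real}"
  define U where "U = topspace X - {h 0}"
  define W where "W = h ` cball 0 1 - {h 0}"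
  \<comment> \<open>The segment on the ray through \<open>z\<close> from \<open>z\<close> itself at
    time 0 to its radial projection to the unit sphere at time 1.\<close>
  define G where "G = (\<lambda>(t, z). ((1 - t) + t / norm z) *\<^sub>R z :: 'n)"
  define H where "H = (\<lambda>(t, x). if x \<in> A then x else h (G (t, inv_into (ball 0 1) h x)))"
  have AX: "A \<subseteq> topspace X" using A by (rule closedin_subset)
  have sph: "h z \<in> A" if "norm z = 1" for z using hA that by auto
  have bal: "h z \<in> topspace X - A" if "norm z < 1" for z using im that by auto
  have h0: "h 0 \<in> topspace X - A" using bal[of 0] by simp
  have hX: "h z \<in> topspace X" if "norm z \<le> 1" for z
    using h that by (auto simp: continuous_map_def Pi_iff)
  have h_eq0: "z = 0" if "h z = h 0" "norm z \<le> 1" for z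
  proof -
    have "norm z \<noteq> 1" using that sph[of z] h0 by auto
    with that inj show ?thesis by (auto simp: inj_on_def)
  qed
  have AU: "A \<subseteq> U" using AX h0 by (auto simp: U_def)
  have inv: "inv_into (ball 0 1) h (h z) = z" if "norm z < 1" for z
    using inj that by simp
  \<comment> \<open>The norm moves linearly from \<open>norm z\<close> to 1, so the path neither
    leaves the closed ball nor meets the centre.\<close>
  have nG: "norm (G (t, z)) = (1 - t) * norm z + t" if "t \<in> ?I" "z \<noteq> 0" for t z
  proof -
    have "0 \<le> (1 - t) + t / norm z" using that by auto
    then have "norm (G (t, z)) = ((1 - t) + t / norm z) * norm z"
      unfolding G_def by (simp only: case_prod_conv norm_scaleR abs_of_nonneg)
    then show ?thesis using that by (simp add: distrib_right)
  qed
  have nG1: "norm (G (t, z)) \<le> 1" if "t \<in> ?I" "z \<noteq> 0" "norm z \<le> 1" for t z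
    using that nG[of t z] mult_left_le[of "norm z" "1 - t"] by auto
  have nG0: "G (t, z) \<noteq> 0" if "t \<in> ?I" "z \<noteq> 0" for t z
  proof -
    have "0 < (1 - t) * norm z + t"
      using that by (cases "t = 0") (auto intro: add_nonneg_pos)
    then show ?thesis using nG[OF that] by auto
  qed
  \<comment> \<open>This formula also holds on the unit sphere, where \<open>h\<close> need not be
    injective: \<open>G\<close> fixes such points, and \<open>H\<close> fixes their images in
    \<open>A\<close>.\<close>
  have H_h: "H (t, h z) = h (G (t, z))" if "norm z \<le> 1" "z \<noteq> 0" for t z
  proof (cases "norm z = 1")
    case True
    then show ?thesis using sph[OF True] by (simp add: H_def G_def)
  next
    case False
    then show ?thesis using that bal[of z] inv[of z] by (simp add: H_def)
  qed
  have surj: "\<exists>z. norm z \<le> 1 \<and> z \<noteq> 0 \<and> x = h z" if "x \<in> U" "x \<notin> A" for x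
  proof -
    have "x \<in> h ` ball 0 1" using that im by (auto simp: U_def)
    then obtain z where "norm z < 1" "x = h z" by auto
    then show ?thesis using that by (intro exI[of _ z]) (auto simp: U_def)
  qed
  have HU: "H (t, x) \<in> U" if "t \<in> ?I" "x \<in> U" for t x
  proof (cases "x \<in> A")
    case True
    then show ?thesis using AU by (auto simp: H_def)
  next
    case False
    then obtain z where z: "norm z \<le> 1" "z \<noteq> 0" "x = h z" using surj \<open>x \<in> U\<close> by blast
    have "h (G (t, z)) \<noteq> h 0" using h_eq0 nG1 nG0 that z by blast
    moreover have "h (G (t, z)) \<in> topspace X" using nG1 hX that z by blast
    ultimately show ?thesis using H_h z by (simp add: U_def)
  qed
  let ?Y = "prod_topology (top_of_set ?I) (subtopology X U)"
  have Ytop: "topspace ?Y = ?I \<times> U" by (auto simp: U_def)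
  have closedW: "closedin X (h ` cball 0 1)"
    using image_compactin[OF _ h, of "cball 0 1"] X
    by (intro compactin_imp_closedin) (auto simp: compactin_subtopology)
  \<comment> \<open>\<open>A\<close> and \<open>W\<close> are closed in \<open>U\<close> and cover
    it. Over \<open>A\<close> the homotopy is the projection; over \<open>W\<close> it is induced
    from the closed cell.\<close>
  have "continuous_map ?Y X H"
  proof (rule pasting_lemma_closed[where I = "UNIV :: bool set" and f = "\<lambda>b. if b then snd else H"
        and T = "\<lambda>b. if b then ?I \<times> A else ?I \<times> W"])
    fix b :: bool
    have "W = h ` cball 0 1 \<inter> U" using hX by (auto simp: W_def U_def)
    then have "closedin (subtopology X U) A" "closedin (subtopology X U) W"
      using A closedW AU by (auto simp: closedin_subtopology)
    then show "closedin ?Y (if b then ?I \<times> A else ?I \<times> W)"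
      by (simp add: closedin_prod_Times_iff)
    show "continuous_map (subtopology ?Y (if b then ?I \<times> A else ?I \<times> W)) X (if b then snd else H)"
    proof (cases b)
      case True
      have "continuous_map ?Y X snd"
        using continuous_map_snd continuous_map_into_fulltopology by blast
      then show ?thesis using True by (simp add: continuous_map_from_subtopology)
    next
      case False
      \<comment> \<open>Over \<open>W\<close>, \<open>H\<close> is obtained by descent:
        \<open>H \<circ> ?q\<close> agrees with the continuous map \<open>h \<circ> G\<close> on the
        punctured cylinder, and the restriction of \<open>?q\<close> to it is a quotient
        map.\<close>
      let ?Z = "prod_topology (top_of_set ?I) (top_of_set (cball (0::'n) 1))"
      let ?P = "prod_topology (top_of_set ?I) X"
      let ?q = "\<lambda>(t, z). (t, h z)"
      have cq: "continuous_map ?Z ?P ?q"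
        unfolding continuous_map_prod_top using h by simp
      have clq: "closed_map ?Z ?P ?q"
        using X by (intro continuous_imp_closed_map_gen[OF _ Hausdorff_imp_kc_space cq])
          (auto simp: compact_space_prod_topology Hausdorff_space_prod_topology
            compact_space_subtopology compact_Times Hausdorff_space_subtopology)
      \<comment> \<open>A closed map stays closed when restricted to a full preimage. The punctured
        cylinder is one because only the centre is sent to \<open>h 0\<close>.\<close>
      have "{x \<in> topspace ?Z. ?q x \<in> ?I \<times> W} = ?I \<times> (cball 0 1 - {0})"
        using h_eq0 by (auto simp: W_def)
      from closed_map_restriction[OF clq this]
      have "quotient_map (subtopology ?Z (?I \<times> (cball 0 1 - {0}))) (subtopology ?P (?I \<times> W)) ?q"
      proof (rule continuous_closed_imp_quotient_map[rotated])
        show "continuous_map (subtopology ?Z (?I \<times> (cball 0 1 - {0}))) (subtopology ?P (?I \<times> W)) ?q"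
          using cq h_eq0 by (auto simp: continuous_map_in_subtopology continuous_map_from_subtopology W_def)
        show "?q ` topspace (subtopology ?Z (?I \<times> (cball 0 1 - {0}))) = topspace (subtopology ?P (?I \<times> W))"
          using h_eq0 hX by (force simp: W_def image_iff)
      qed
      moreover have "continuous_map (subtopology ?Z (?I \<times> (cball 0 1 - {0}))) X (H \<circ> ?q)"
      proof -
        have "continuous_on (?I \<times> (cball 0 1 - {0})) G"
          unfolding G_def case_prod_unfold by (intro continuous_intros) auto
        moreover have "G \<in> ?I \<times> (cball 0 1 - {0}) \<rightarrow> cball 0 1"
          by (clarsimp simp del: split_paired_All) (metis nG1 atLeastAtMost_iff)
        ultimately have "continuous_map (top_of_set (?I \<times> (cball 0 1 - {0}))) (top_of_set (cball 0 1)) G"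
          by simp
        from continuous_map_compose[OF this h]
        have "continuous_map (top_of_set (?I \<times> (cball 0 1 - {0}))) X (h \<circ> G)" .
        moreover have "subtopology ?Z (?I \<times> (cball 0 1 - {0})) = top_of_set (?I \<times> (cball 0 1 - {0}))"
          by (simp add: subtopology_Times subtopology_subtopology Int_absorb1 Int_Diff flip: prod_topology_subtopology_eu)
        ultimately show ?thesis
          by (auto intro!: continuous_map_eq[of _ X "h \<circ> G"] simp: H_h)
      qed
      ultimately have "continuous_map (subtopology ?P (?I \<times> W)) X H"
        by (rule continuous_compose_quotient_map)
      moreover have "subtopology ?Y (?I \<times> W) = subtopology ?P (?I \<times> W)"
      proof -
        have "U \<inter> W = W" using hX by (auto simp: U_def W_def)
        then show ?thesis by (simp add: subtopology_Times subtopology_subtopology)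
      qed
      ultimately show ?thesis using False by simp
    qed
  next
    fix i j x assume "x \<in> topspace ?Y \<inter> (if i then ?I \<times> A else ?I \<times> W) \<inter> (if j then ?I \<times> A else ?I \<times> W)"
    then show "(if i then snd else H) x = (if j then snd else H) x"
      by (auto simp: H_def split: if_splits)
  next
    fix x assume "x \<in> topspace ?Y"
    then obtain t y where x: "x = (t, y)" "t \<in> ?I" "y \<in> U" unfolding Ytop by auto
    show "\<exists>j. j \<in> UNIV \<and> x \<in> (if j then ?I \<times> A else ?I \<times> W) \<and> H x = (if j then snd else H) x"
    proof (cases "y \<in> A")
      case True
      then show ?thesis using x by (intro exI[of _ True]) (simp add: H_def)
    next
      case False
      then have "y \<in> W" using surj[OF x(3)] x(3) by (auto simp: W_def U_def)
      then show ?thesis using x by (intro exI[of _ False]) simp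
    qed
  qed simp
  then have contH: "continuous_map ?Y (subtopology X U) H"
    using HU Ytop by (auto simp: continuous_map_in_subtopology)
  define r where "r x = H (1, x)" for x
  have H0: "H (0, x) = x" if "x \<in> U" for x
  proof (cases "x \<in> A")
    case False
    then obtain z where z: "norm z \<le> 1" "z \<noteq> 0" "x = h z" using surj[OF \<open>x \<in> U\<close>] by blast
    then show ?thesis by (simp add: H_h) (simp add: G_def)
  qed (simp add: H_def)
  have rA: "r x \<in> A" if "x \<in> U" for x
  proof (cases "x \<in> A")
    case False
    then obtain z where z: "norm z \<le> 1" "z \<noteq> 0" "x = h z" using surj[OF \<open>x \<in> U\<close>] by blast
    then show ?thesis using sph[of "G (1, z)"] nG[of 1 z] by (simp add: H_h r_def)
  qed (simp add: H_def r_def)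
  have "homotopic_with (\<lambda>x. True) (subtopology X U) (subtopology X U) id r"
    using contH H0 by (subst homotopic_with) (auto simp: r_def U_def intro!: exI[of _ H])
  moreover have "continuous_map (subtopology X U) (subtopology X U) r"
    using calculation homotopic_with_imp_continuous_maps by blast
  then have "continuous_map (subtopology X U) (subtopology X A) r"
    using rA by (auto simp: continuous_map_in_subtopology Pi_iff)
  then have "retraction_maps (subtopology X U) (subtopology X A) r id"
    using AU by (auto simp: retraction_maps_def r_def H_def continuous_map_in_subtopology)
  ultimately show ?thesis unfolding U_def
    using deformation_retract_imp_homotopy_equivalent_space homotopic_with_symD by blast
qed

text \<open>A continuous map from a compact space to a Hausdorff space is closed. The open ball is
  the full preimage of the complement of \<open>A\<close>, so the restriction remains closed and,
  being bijective and continuous, is a homeomorphism.\<close>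

lemma cell_interior_homeomorphic_map:
  fixes h :: "'n::euclidean_space \<Rightarrow> 'a"
  assumes X: "Hausdorff_space X"
    and h: "continuous_map (top_of_set (cball 0 1)) X h"
    and hA: "h ` sphere 0 1 \<subseteq> A" and inj: "inj_on h (ball 0 1)"
    and im: "h ` ball 0 1 = topspace X - A"
  shows "homeomorphic_map (top_of_set (ball 0 1)) (subtopology X (topspace X - A)) h"
proof -
  have cl: "closed_map (top_of_set (cball 0 1)) X h"
    using X by (intro continuous_imp_closed_map[OF h]) (auto simp: compact_space_subtopology)
  have "z \<in> ball 0 1" if "norm z \<le> 1" "h z \<notin> A" for z
    using that hA by (cases "norm z = 1") (auto simp: image_subset_iff)
  then have "{z \<in> topspace (top_of_set (cball 0 1)). h z \<in> topspace X - A} = ball 0 1"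
    using im by auto
  from closed_map_restriction[OF cl this]
  have "closed_map (top_of_set (ball 0 1)) (subtopology X (topspace X - A)) h"
    by (simp add: subtopology_subtopology Int_absorb1 ball_subset_cball)
  moreover have "continuous_map (top_of_set (ball 0 1)) (subtopology X (topspace X - A)) h"
    using continuous_map_from_subtopology_mono[OF h ball_subset_cball] im
    by (auto simp: continuous_map_in_subtopology)
  ultimately show ?thesis
    using im inj by (intro bijective_closed_imp_homeomorphic_map) auto
qed

text \<open>The dimension enters only through the value \<open>s\<close> for the boundary sphere, so
  one statement serves for edges and for faces.\<close>

lemma has_euler_attach_cell:
  fixes h :: "'n::euclidean_space \<Rightarrow> 'a"
  assumes X: "Hausdorff_space X" and A: "closedin X A"
    and h: "continuous_map (top_of_set (cball 0 1)) X h"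
    and hA: "h ` sphere 0 1 \<subseteq> A" and inj: "inj_on h (ball 0 1)"
    and im: "h ` ball 0 1 = topspace X - A"
    and a: "has_euler (subtopology X A) {} a"
    and s: "has_euler (top_of_set (sphere (0::'n) 1)) {} s"
  shows "has_euler X {} (a + 1 - s)"
proof -
  let ?U = "topspace X - {h 0}" and ?D = "topspace X - A"
  have AX: "A \<subseteq> topspace X" using A by (rule closedin_subset)
  have h0: "h 0 \<in> ?D" unfolding im[symmetric] by simp
  have hom: "homeomorphic_map (top_of_set (ball 0 1)) (subtopology X ?D) h"
    by (rule cell_interior_homeomorphic_map[OF X h hA inj im])
  have U: "has_euler (subtopology X ?U) {} a"
    using has_euler_homotopy_equivalent[OF a]
      punctured_cell_homotopy_equivalent[OF X A h hA inj im] homotopy_equivalent_space_sym by blast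
  have "contractible_space (top_of_set (ball (0::'n) 1))"
    by (simp add: convex_imp_contractible contractible_space_top_of_set)
  then have "has_euler (top_of_set (ball (0::'n) 1)) {} 1"
    by (intro has_euler_contractible) auto
  then have D: "has_euler (subtopology X ?D) {} 1"
    using has_euler_homotopy_equivalent homeomorphic_imp_homotopy_equivalent_space
      homeomorphic_map_imp_homeomorphic_space[OF hom] by blast
  \<comment> \<open>The detour through radius 1/2 is made because the unit sphere does not lie in
    the open unit ball.\<close>
  have "sphere (0::'n) 1 homotopy_eqv sphere (0::'n) (1/2)"
    by (intro homeomorphic_imp_homotopy_eqv homeomorphic_spheres) auto
  moreover have "sphere (0::'n) (1/2) homotopy_eqv ball (0::'n) 1 - {0}"
    using homotopy_eqv_rel_frontier_punctured_convex[of "cball (0::'n) (1/2)" 0 "ball 0 1"]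
    by (auto simp: subset_eq rel_interior_nonempty_interior rel_frontier_nonempty_interior affine_hull_nonempty_interior)
  ultimately have "has_euler (top_of_set (ball (0::'n) 1 - {0})) {} s"
    using s by (meson has_euler_homotopy_equivalent)
  moreover have "homeomorphic_map (top_of_set (ball 0 1 - {0})) (subtopology X (?D - {h 0})) h"
  proof -
    have "h ` (ball 0 1 - {0}) = ?D - {h 0}"
      using inj im by (subst inj_on_image_set_diff[of h "ball 0 1"]) auto
    then show ?thesis
      using homeomorphic_map_subtopologies[OF hom, of "ball 0 1 - {0}" "?D - {h 0}"] im
      by (simp add: subtopology_subtopology Int_absorb1 Int_absorb2)
  qed
  ultimately have "has_euler (subtopology X (?D - {h 0})) {} s"
    by (meson has_euler_homotopy_equivalent homeomorphic_imp_homotopy_equivalent_space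
      homeomorphic_map_imp_homeomorphic_space)
  moreover have "subtopology (subtopology X ?D) (?U - A) = subtopology X (?D - {h 0})"
    unfolding subtopology_subtopology by (rule arg_cong[where f = "subtopology X"]) auto
  ultimately have "has_euler (subtopology X ?D) (?U - A) (1 - s)"
    using D by (intro has_euler_relative) simp_all
  then have "has_euler (subtopology X (topspace X)) ?U (1 - s)"
  proof (rule has_euler_excision)
    have "openin X ?U"
      using X h0 by (intro openin_diff) (auto simp: closedin_Hausdorff_singleton)
    \<comment> \<open>\<open>A\<close> is closed and \<open>?U\<close> is open, so the condition for
      excision reduces to \<open>A \<subseteq> ?U\<close>.\<close>
    then show "X closure_of A \<subseteq> X interior_of ?U"
      using A AX h0 by (auto simp: closure_of_closedin interior_of_openin)
  qed auto
  then have "has_euler X {} (a + (1 - s))"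
    using U by (intro has_euler_pair) simp_all
  then show ?thesis by (simp add: algebra_simps)
qed

section \<open>Decompositions of surfaces\<close>

text \<open>All boundaries lie in the initial set \<open>A\<close>, so the cells can be attached in
  any order. Closedness of the union is carried through the induction because attaching the next
  cell requires it.\<close>

lemma has_euler_attach_cells:
  assumes S: "Hausdorff_space S" and A: "closedin S A" and fin: "finite I"
    and h: "\<And>i. i \<in> I \<Longrightarrow> \<exists>h. continuous_map (top_of_set (cball (0::'n::euclidean_space) 1)) S h \<and>
          h ` sphere 0 1 \<subseteq> A \<and> inj_on h (ball 0 1) \<and> h ` ball 0 1 = D i"
    and DA: "\<And>i. i \<in> I \<Longrightarrow> disjnt (D i) A" and disj: "pairwise (\<lambda>i j. disjnt (D i) (D j)) I"
    and a: "has_euler (subtopology S A) {} a"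
    and s: "has_euler (top_of_set (sphere (0::'n) 1)) {} s"
  shows "closedin S (A \<union> (\<Union>i\<in>I. D i)) \<and>
    has_euler (subtopology S (A \<union> (\<Union>i\<in>I. D i))) {} (a + int (card I) * (1 - s))"
  using fin h DA disj
proof (induction I rule: finite_induct)
  case empty
  then show ?case using A a by simp
next
  case (insert i I)
  define B where "B = A \<union> (\<Union>i\<in>I. D i)"
  have IH: "closedin S B" "has_euler (subtopology S B) {} (a + int (card I) * (1 - s))"
    using insert.IH insert.prems by (auto simp: B_def pairwise_insert)
  obtain h where h: "continuous_map (top_of_set (cball (0::'n) 1)) S h"
    "h ` sphere 0 1 \<subseteq> A" "inj_on h (ball 0 1)" "h ` ball 0 1 = D i"
    using insert.prems(1)[of i] by blast
  have eq: "A \<union> (\<Union>i\<in>insert i I. D i) = B \<union> D i" by (auto simp: B_def)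
  have "cball (0::'n) 1 = ball 0 1 \<union> sphere 0 1" by auto
  then have "h ` cball 0 1 = D i \<union> h ` sphere 0 1"
    unfolding h(4)[symmetric] image_Un[symmetric] by simp
  \<comment> \<open>The open cell may be replaced by the image of the closed one, which is compact
    and therefore closed in \<open>S\<close>.\<close>
  then have eq': "B \<union> D i = B \<union> h ` cball 0 1" using h(2) by (auto simp: B_def)
  have "compactin S (h ` cball 0 1)"
    using image_compactin[OF _ h(1), of "cball 0 1"] by (simp add: compactin_subtopology)
  then have cl: "closedin S (B \<union> D i)"
    using IH(1) compactin_imp_closedin[OF S] unfolding eq' by blast
  have DB: "D i \<inter> B = {}"
    using insert.prems(2)[of i] insert.prems(3) insert.hyps
    by (fastforce simp: B_def disjnt_def pairwise_insert)
  have top: "topspace (subtopology S (B \<union> D i)) = B \<union> D i"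
    using closedin_subset[OF cl] by auto
  have "has_euler (subtopology S (B \<union> D i)) {} ((a + int (card I) * (1 - s)) + 1 - s)"
  proof (rule has_euler_attach_cell[where A = B and h = h])
    show "Hausdorff_space (subtopology S (B \<union> D i))" using S by (rule Hausdorff_space_subtopology)
    show "closedin (subtopology S (B \<union> D i)) B"
      using IH(1) by (auto simp: closedin_subtopology)
    show "continuous_map (top_of_set (cball 0 1)) (subtopology S (B \<union> D i)) h"
      using h(1) by (auto simp: continuous_map_in_subtopology eq')
    show "h ` sphere 0 1 \<subseteq> B" using h(2) by (auto simp: B_def)
    show "h ` ball 0 1 = topspace (subtopology S (B \<union> D i)) - B"
      unfolding top h(4) using DB by auto
    show "has_euler (subtopology (subtopology S (B \<union> D i)) B) {} (a + int (card I) * (1 - s))"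
      using IH(2) by (simp add: subtopology_subtopology Int_absorb1)
  qed (use h s in auto)
  then show ?case
    unfolding eq using cl insert.hyps by (simp add: algebra_simps)
qed

section \<open>Boundary spheres of edges and faces\<close>

lemma has_euler_sphere_real: "has_euler (top_of_set (sphere (0::real) 1)) {} 2"
proof -
  have "sphere (0::real) 1 = {- 1, 1}" by (auto simp: dist_real_def)
  then show ?thesis using has_euler_finite_Hausdorff[of "euclidean :: real topology" "{- 1, 1}"] by simp
qed

lemma unit_circle_obtain_angle:
  assumes "z \<in> sphere (0::complex) 1"
  obtains \<theta> where "0 \<le> \<theta>" "\<theta> < 2 * pi" "z = cis \<theta>"
  using assms Arg2pi[of z] by (auto simp: is_Arg_def cis_conv_exp)

lemma inj_on_cis_period: "inj_on cis {0..<2 * pi}"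
proof (rule inj_onI)
  fix s t assume st: "s \<in> {0..<2 * pi}" "t \<in> {0..<2 * pi}" "cis s = cis t"
  have "Arg2pi (cis u) = u" if "u \<in> {0..<2 * pi}" for u
    using that by (intro Arg2pi_unique[of 1]) (auto simp: cis_conv_exp)
  with st show "s = t" by metis
qed

lemma has_euler_unit_circle: "has_euler (top_of_set (sphere (0::complex) 1)) {} 0"
proof -
  \<comment> \<open>The 1-cell is the unit ball of the real line, the interval from -1 to 1. The
    angle runs from 0 to \<open>2 * pi\<close>, so both endpoints go to 1 and the interior covers
    the rest of the circle once.\<close>
  define h where "h t = cis (pi * (t + 1))" for t :: real
  have cont: "continuous_on (cball 0 1) h"
    unfolding h_def by (intro continuous_intros)
  have "h ` ball 0 1 = sphere 0 1 - {1}"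
  proof
    show "h ` ball 0 1 \<subseteq> sphere 0 1 - {1}"
    proof clarsimp
      fix t :: real assume "\<bar>t\<bar> < 1"
      then have "0 < t + 1" "t + 1 < 2" by auto
      then have "pi * (t + 1) \<in> {0..<2 * pi}" "pi * (t + 1) \<noteq> 0" by auto
      moreover have "0 \<in> {0..<2 * pi}" by simp
      ultimately have "cis (pi * (t + 1)) \<noteq> cis 0"
        using inj_on_cis_period unfolding inj_on_def by blast
      then show "norm (h t) = 1 \<and> h t \<noteq> 1" by (simp add: h_def)
    qed
    show "sphere 0 1 - {1} \<subseteq> h ` ball 0 1"
    proof
      fix z :: complex assume z: "z \<in> sphere 0 1 - {1}"
      then obtain \<theta> where \<theta>: "0 \<le> \<theta>" "\<theta> < 2 * pi" "z = cis \<theta>"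
        using unit_circle_obtain_angle by blast
      then have "\<theta> \<noteq> 0" using z by auto
      then show "z \<in> h ` ball 0 1" using \<theta>
        by (intro image_eqI[of _ _ "\<theta> / pi - 1"]) (auto simp: h_def dist_real_def field_simps abs_less_iff)
    qed
  qed
  moreover have "inj_on h (ball 0 1)"
  proof (rule inj_onI)
    fix s t :: real assume st: "s \<in> ball 0 1" "t \<in> ball 0 1" "h s = h t"
    have "pi * (u + 1) \<in> {0..<2 * pi}" if "u \<in> ball 0 1" for u
    proof -
      have "0 < u + 1" "u + 1 < 2" using that by (auto simp: dist_real_def)
      then show ?thesis by auto
    qed
    with st have "pi * (s + 1) = pi * (t + 1)"
      using inj_on_cis_period unfolding inj_on_def h_def by blast
    then show "s = t" by simp
  qed
  moreover have "h ` sphere 0 1 \<subseteq> {1}"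
  proof clarsimp
    fix t :: real assume "\<bar>t\<bar> = 1"
    then have "t = 1 \<or> t = - 1" by auto
    then show "h t = 1" by (auto simp: h_def complex_eq_iff)
  qed
  moreover have "has_euler (subtopology (top_of_set (sphere (0::complex) 1)) {1}) {} 1"
    by (rule has_euler_singleton[of _ 1]) auto
  moreover have "continuous_map (top_of_set (cball 0 1)) (top_of_set (sphere 0 1)) h"
    using cont by (auto simp: h_def)
  ultimately have "has_euler (top_of_set (sphere (0::complex) 1)) {} (1 + 1 - 2)"
    by (intro has_euler_attach_cell[where h = h and A = "{1}"] has_euler_sphere_real)
      (auto simp: Hausdorff_space_subtopology)
  then show ?thesis by simp
qed

section \<open>The embedded graph and the attaching maps of the faces\<close>

definition skeleton :: "('a, 'e, 'm) cell_decomposition_scheme \<Rightarrow> 'a set" where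
  "skeleton K = verts K \<union> (\<Union>e\<in>edges K. open_edge K e)"

lemma has_euler_skeleton:
  assumes S: "Hausdorff_space S" and K: "embedded_finite_graph S K"
  shows "closedin S (skeleton K) \<and>
    has_euler (subtopology S (skeleton K)) {} (int (card (verts K)) - int (card (edges K)))"
proof -
  have V: "finite (verts K)" "verts K \<subseteq> topspace S" "finite (edges K)"
    and e: "\<And>e. e \<in> edges K \<Longrightarrow> pathin S (epath K e)" "\<And>e. e \<in> edges K \<Longrightarrow> inj_on (epath K e) {0<..<1}"
      "\<And>e b. e \<in> edges K \<Longrightarrow> edge_end K e b \<in> verts K"
      "\<And>e. e \<in> edges K \<Longrightarrow> disjnt (open_edge K e) (verts K)"
    and disj: "pairwise (\<lambda>e e'. disjnt (open_edge K e) (open_edge K e')) (edges K)"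
    using K by (simp_all add: embedded_finite_graph_def)
  have "closedin S (verts K \<union> (\<Union>e\<in>edges K. open_edge K e)) \<and>
    has_euler (subtopology S (verts K \<union> (\<Union>e\<in>edges K. open_edge K e))) {}
      (int (card (verts K)) + int (card (edges K)) * (1 - 2))"
  proof (rule has_euler_attach_cells[OF S _ V(3) _ e(4) disj _ has_euler_sphere_real])
    show "closedin S (verts K)" by (rule closedin_Hausdorff_finite[OF S V(2,1)])
    show "has_euler (subtopology S (verts K)) {} (int (card (verts K)))"
      by (rule has_euler_finite_Hausdorff[OF S V(1,2)])
    fix e assume eK: "e \<in> edges K"
    \<comment> \<open>The affine change of parameter from the unit ball of the real line to the
      interval on which edges are parametrized.\<close>
    define u where "u t = (t + 1) / 2" for t :: real
    have ball: "u ` ball 0 1 = {0<..<1}"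
    proof -
      have "x \<in> u ` ball 0 1" if "0 < x" "x < 1" for x
        using that by (intro image_eqI[of _ _ "2 * x - 1"]) (auto simp: u_def dist_real_def abs_less_iff)
      then show ?thesis by (auto simp: u_def dist_real_def)
    qed
    have "continuous_map (top_of_set (cball 0 1)) (top_of_set {0..1}) u"
      by (auto simp: u_def dist_real_def intro!: continuous_intros)
    then have "continuous_map (top_of_set (cball 0 1)) S (epath K e \<circ> u)"
      using e(1)[OF eK] unfolding pathin_def by (rule continuous_map_compose)
    moreover have "(epath K e \<circ> u) ` sphere 0 1 \<subseteq> verts K"
    proof clarsimp
      fix t :: real assume "\<bar>t\<bar> = 1"
      then have "t = 1 \<or> t = - 1" by auto
      then show "epath K e (u t) \<in> verts K"
        using e(3)[OF eK, of True] e(3)[OF eK, of False] by (auto simp: u_def edge_end_def)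
    qed
    moreover have "inj_on (epath K e \<circ> u) (ball 0 1)"
      by (rule comp_inj_on) (use e(2)[OF eK] in \<open>simp_all add: ball\<close>, simp add: u_def inj_on_def)
    moreover have "(epath K e \<circ> u) ` ball 0 1 = open_edge K e"
      unfolding image_comp[symmetric] ball open_edge_def ..
    ultimately show "\<exists>h. continuous_map (top_of_set (cball (0::real) 1)) S h \<and>
        h ` sphere 0 1 \<subseteq> verts K \<and> inj_on h (ball 0 1) \<and> h ` ball 0 1 = open_edge K e" by blast
  qed auto
  then show ?thesis by (simp add: skeleton_def)
qed

text \<open>The circle is covered by the arcs of the polygon, and each arc is mapped along a closed
  edge, which consists of an open edge and two vertices.\<close>

lemma boundary_walk_sphere_subset:
  assumes K: "embedded_finite_graph S K" and w: "fst ` set w \<subseteq> edges K"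
    and h: "if w = [] then \<exists>v\<in>verts K. \<forall>z\<in>sphere 0 1. h z = v
           else \<forall>i<length w. \<forall>t\<in>{0..1}.
                  h (cis (2 * pi * (real i + t) / real (length w))) = traversal K (w ! i) t"
  shows "h ` sphere 0 1 \<subseteq> skeleton K"
proof (cases "w = []")
  case True
  then show ?thesis using h by (auto simp: skeleton_def)
next
  case False
  have ep: "epath K e t \<in> skeleton K" if "e \<in> edges K" "t \<in> {0..1}" for e t
  proof (cases "t = 0 \<or> t = 1")
    case True
    moreover have "edge_end K e b \<in> skeleton K" for b
      using K that(1) by (auto simp: embedded_finite_graph_def skeleton_def)
    from this[of True] this[of False] show ?thesis using True by (auto simp: edge_end_def)
  next
    case False
    then have "epath K e t \<in> open_edge K e" using that by (auto simp: open_edge_def)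
    then show ?thesis using that(1) by (auto simp: skeleton_def)
  qed
  show ?thesis
  proof
    fix x assume "x \<in> h ` sphere 0 1"
    then obtain \<theta> where \<theta>: "0 \<le> \<theta>" "\<theta> < 2 * pi" "x = h (cis \<theta>)"
      using unit_circle_obtain_angle by (metis imageE)
    define n where "n = real (length w)"
    have n: "n > 0" using False by (simp add: n_def)
    \<comment> \<open>The angle measured in arcs: its integer part is the index of the arc, and its
      fractional part is the parameter on that arc. As the angle is less than \<open>2 * pi\<close>,
      the index is less than the length of the walk.\<close>
    define y where "y = n * \<theta> / (2 * pi)"
    define i where "i = nat \<lfloor>y\<rfloor>"
    define t where "t = y - real i"
    have y: "0 \<le> y" "y < n" using \<theta> n by (auto simp: y_def field_simps)
    then have i: "i < length w" by (simp add: i_def n_def nat_less_iff floor_less_iff)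
    have t: "t \<in> {0..1}" using y(1) by (auto simp: t_def i_def) linarith+
    have "2 * pi * (real i + t) / real (length w) = \<theta>"
      using n by (simp add: t_def y_def flip: n_def)
    then have "x = traversal K (w ! i) t" using h False i t \<theta>(3) by metis
    moreover have "fst (w ! i) \<in> edges K" using w i by (auto simp: image_subset_iff)
    ultimately show "x \<in> skeleton K" using ep t by (auto simp: traversal_def)
  qed
qed

text \<open>The first four properties are those needed to attach the face as a 2-cell. The last
  describes faces with empty boundary walk, for the proof that there are finitely many
  faces.\<close>

lemma face_characteristic_map:
  assumes K: "decomposition S K" and \<Sigma>: "\<Sigma> \<in> faces S K"
  obtains h where "continuous_map (top_of_set (cball (0::complex) 1)) S h"
    "h ` sphere 0 1 \<subseteq> skeleton K" "inj_on h (ball 0 1)" "h ` ball 0 1 = \<Sigma>"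
    "walk K \<Sigma> = [] \<Longrightarrow> \<exists>v\<in>verts K. h ` sphere 0 1 = {v}"
proof -
  have "\<Sigma> \<subseteq> topspace S"
    using connected_components_of_subset \<Sigma> unfolding faces_def by fastforce
  have "boundary_walk S K \<Sigma> (walk K \<Sigma>)" and G: "embedded_finite_graph S K"
    using K \<Sigma> by (auto simp: decomposition_def)
  then obtain h where w: "fst ` set (walk K \<Sigma>) \<subseteq> edges K"
    and h: "continuous_map (top_of_set (cball (0::complex) 1)) S h"
      "homeomorphic_map (top_of_set (ball (0::complex) 1)) (subtopology S \<Sigma>) h"
    and b: "if walk K \<Sigma> = [] then \<exists>v\<in>verts K. \<forall>z\<in>sphere 0 1. h z = v
           else \<forall>i<length (walk K \<Sigma>). \<forall>t\<in>{0..1}.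
             h (cis (2 * pi * (real i + t) / real (length (walk K \<Sigma>)))) = traversal K (walk K \<Sigma> ! i) t"
    unfolding boundary_walk_def by blast
  have im: "h ` ball 0 1 = \<Sigma>"
    using homeomorphic_imp_surjective_map[OF h(2)] \<open>\<Sigma> \<subseteq> topspace S\<close> by auto
  have inj: "inj_on h (ball 0 1)"
    using homeomorphic_imp_injective_map[OF h(2)] by simp
  have "sphere (0::complex) 1 \<noteq> {}" by simp
  then have "\<exists>v\<in>verts K. h ` sphere 0 1 = {v}" if "walk K \<Sigma> = []"
    using b that by (metis image_constant_conv image_cong)
  with that[OF h(1) boundary_walk_sphere_subset[OF G w b] inj im] show ?thesis by blast
qed

section \<open>Faces are open and finite in number\<close>

lemma surface_locally_connected:
  assumes "connected_compact_surface S" shows "locally_connected_space S"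
  unfolding locally_connected_space
proof (intro allI impI)
  fix V x assume V: "openin S V \<and> x \<in> V"
  then have "x \<in> topspace S" using openin_subset by blast
  then obtain W where W: "openin S W" "x \<in> W" "subtopology S W homeomorphic_space (euclidean :: complex topology)"
    using assms unfolding connected_compact_surface_def by blast
  have "locally_connected_space (euclidean :: complex topology)"
    unfolding locally_connected_space
  proof (intro allI impI)
    fix V and x :: complex assume "openin euclidean V \<and> x \<in> V"
    then obtain e where "e > 0" "ball x e \<subseteq> V" by (auto simp: open_contains_ball)
    then show "\<exists>U. openin euclidean U \<and> connectedin euclidean U \<and> x \<in> U \<and> U \<subseteq> V"
      by (intro exI[of _ "ball x e"]) auto
  qed
  then have "locally_connected_space (subtopology S W)"
    using W(3) homeomorphic_locally_connected_space by blast
  moreover have "openin (subtopology S W) (V \<inter> W)" "x \<in> V \<inter> W"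
    using V W by (auto simp: openin_open_subtopology openin_Int)
  ultimately obtain U where "openin (subtopology S W) U" "connectedin (subtopology S W) U" "x \<in> U" "U \<subseteq> V \<inter> W"
    unfolding locally_connected_space by metis
  then show "\<exists>U. openin S U \<and> connectedin S U \<and> x \<in> U \<and> U \<subseteq> V"
    using W(1) by (auto simp: openin_open_subtopology connectedin_subtopology)
qed

text \<open>The skeleton is closed, and in a locally connected space the components of an open set
  are open.\<close>

lemma face_openin:
  assumes S: "connected_compact_surface S" and K: "decomposition S K" and \<Sigma>: "\<Sigma> \<in> faces S K"
  shows "openin S \<Sigma>"
proof -
  have "closedin S (skeleton K)"
    using has_euler_skeleton[of S K] S K by (auto simp: connected_compact_surface_def decomposition_def)
  then have "openin S (topspace S - skeleton K)" by blast
  then show ?thesis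
    using surface_locally_connected[OF S] \<Sigma>
    unfolding locally_connected_space_open_connected_components faces_def skeleton_def by blast
qed

text \<open>A punctured disc around \<open>v\<close> is connected and meets \<open>\<Sigma>\<close>, so it lies in \<open>\<Sigma>\<close>; hence
  \<open>insert v \<Sigma>\<close> is open as well as closed.\<close>

lemma one_point_closure_eq_surface:
  assumes S: "connected_compact_surface S" and op: "openin S \<Sigma>" and "\<Sigma> \<noteq> {}"
    and v: "v \<in> topspace S" "v \<notin> \<Sigma>" and cl: "closedin S (insert v \<Sigma>)"
  shows "insert v \<Sigma> = topspace S"
proof -
  have conn: "\<And>T. openin S T \<Longrightarrow> closedin S T \<Longrightarrow> T = {} \<or> T = topspace S"
    using S unfolding connected_compact_surface_def connected_space_clopen_in by blast
  obtain U where U: "openin S U" "v \<in> U" "subtopology S U homeomorphic_space (euclidean :: complex topology)"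
    using S v(1) unfolding connected_compact_surface_def by blast
  have US: "U \<subseteq> topspace S" using U(1) by (rule openin_subset)
  obtain f g where fg: "homeomorphic_maps (subtopology S U) (euclidean :: complex topology) f g"
    using U(3) unfolding homeomorphic_space_def by blast
  \<comment> \<open>The chart identifies the punctured neighbourhood with a punctured plane, which
    is connected.\<close>
  have "g ` (- {f v}) = U - {v}"
  proof -
    have gf: "\<And>x. x \<in> U \<Longrightarrow> g (f x) = x" "\<And>y. f (g y) = y" "\<And>y. g y \<in> U"
      using fg US by (auto simp: homeomorphic_maps_def continuous_map_def Pi_iff)
    show ?thesis
    proof (intro equalityI subsetI)
      fix x assume "x \<in> g ` (- {f v})"
      then show "x \<in> U - {v}" using gf by auto
    next
      fix x assume "x \<in> U - {v}"
      then have "x = g (f x)" "f x \<noteq> f v" using gf(1)[of x] gf(1)[OF U(2)] by auto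
      then show "x \<in> g ` (- {f v})" by blast
    qed
  qed
  moreover have "connectedin (euclidean :: complex topology) (- {f v})"
    by (simp add: connected_punctured_universe)
  moreover have "continuous_map euclidean S g"
    using fg by (auto simp: homeomorphic_maps_def continuous_map_in_subtopology)
  ultimately have con: "connectedin S (U - {v})"
    using connectedin_continuous_map_image by metis
  \<comment> \<open>Otherwise removing \<open>U\<close> from the closed set
    \<open>insert v \<Sigma>\<close> would leave \<open>\<Sigma>\<close>, which would then be
    closed, open and nonempty, hence all of \<open>S\<close>, although it misses
    \<open>v\<close>.\<close>
  have "\<Sigma> \<inter> U \<noteq> {}"
  proof
    assume "\<Sigma> \<inter> U = {}"
    then have "\<Sigma> = insert v \<Sigma> - U" using U(2) v(2) by auto
    then have "closedin S \<Sigma>" using closedin_diff[OF cl U(1)] by simp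
    then show False using conn[OF op] \<open>\<Sigma> \<noteq> {}\<close> v by auto
  qed
  have "U - {v} \<subseteq> \<Sigma>"
  proof (rule ccontr)
    assume "\<not> U - {v} \<subseteq> \<Sigma>"
    moreover have "openin S (topspace S - insert v \<Sigma>)" using cl by blast
    moreover have "U - {v} \<subseteq> \<Sigma> \<union> (topspace S - insert v \<Sigma>)" using US by auto
    moreover have "\<Sigma> \<inter> (U - {v}) \<noteq> {}" using \<open>\<Sigma> \<inter> U \<noteq> {}\<close> v(2) by auto
    moreover have "(topspace S - insert v \<Sigma>) \<inter> (U - {v}) \<noteq> {}"
      using \<open>\<not> U - {v} \<subseteq> \<Sigma>\<close> US by auto
    moreover have "\<Sigma> \<inter> (topspace S - insert v \<Sigma>) \<inter> (U - {v}) = {}" by auto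
    ultimately show False using con op unfolding connectedin by blast
  qed
  then have "insert v \<Sigma> = \<Sigma> \<union> U" using U(2) by auto
  then have "openin S (insert v \<Sigma>)" using op U(1) by auto
  then show ?thesis using conn[OF _ cl] by blast
qed

text \<open>A face with empty walk is the complement of a vertex, so there are at most as many of
  these as vertices. Every other face contains an edge occurrence, and each of the finitely many
  edges has only two occurrences.\<close>

lemma finite_faces:
  assumes S: "connected_compact_surface S" and K: "decomposition S K"
  shows "finite (faces S K)"
proof -
  have Hd: "Hausdorff_space S" using S by (simp add: connected_compact_surface_def)
  have V: "finite (verts K)" "verts K \<subseteq> topspace S" "finite (edges K)"
    using K by (auto simp: decomposition_def embedded_finite_graph_def)
  have "\<Sigma> \<in> (\<lambda>v. topspace S - {v}) ` verts K" if \<Sigma>: "\<Sigma> \<in> faces S K" "walk K \<Sigma> = []" for \<Sigma>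
  proof -
    obtain h v where h: "continuous_map (top_of_set (cball (0::complex) 1)) S h"
      "h ` ball 0 1 = \<Sigma>" "v \<in> verts K" "h ` sphere 0 1 = {v}"
      using face_characteristic_map[OF K \<Sigma>(1)] \<Sigma>(2) by metis
    have "\<Sigma> \<noteq> {}" "v \<notin> \<Sigma>"
      using \<Sigma>(1) h(3) nonempty_connected_components_of connected_components_of_subset
      unfolding faces_def by fastforce+
    have "cball (0::complex) 1 = ball 0 1 \<union> sphere 0 1" by auto
    then have "h ` cball 0 1 = insert v \<Sigma>" using h(2,4) by (simp add: image_Un)
    moreover have "compactin S (h ` cball 0 1)"
      using image_compactin[OF _ h(1), of "cball 0 1"] by (simp add: compactin_subtopology)
    ultimately have "closedin S (insert v \<Sigma>)" using compactin_imp_closedin[OF Hd] by metis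
    with one_point_closure_eq_surface[OF S face_openin[OF S K \<Sigma>(1)] \<open>\<Sigma> \<noteq> {}\<close> _ \<open>v \<notin> \<Sigma>\<close>] V h(3)
    have "\<Sigma> = topspace S - {v}" using \<open>v \<notin> \<Sigma>\<close> by auto
    then show ?thesis using h(3) by blast
  qed
  moreover have "\<Sigma> \<in> fst ` (\<Union>e\<in>edges K. {(\<Sigma>, i). \<Sigma> \<in> faces S K \<and> i < length (walk K \<Sigma>) \<and> fst (walk K \<Sigma> ! i) = e})"
    if \<Sigma>: "\<Sigma> \<in> faces S K" "walk K \<Sigma> \<noteq> []" for \<Sigma>
  proof -
    have "fst ` set (walk K \<Sigma>) \<subseteq> edges K"
      using K \<Sigma>(1) by (simp add: decomposition_def boundary_walk_def)
    then have "fst (walk K \<Sigma> ! 0) \<in> edges K" using \<Sigma>(2) by (auto simp: image_subset_iff)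
    then show ?thesis using \<Sigma> by (intro image_eqI[of _ _ "(\<Sigma>, 0)"]) auto
  qed
  \<comment> \<open>An infinite set has \<open>card\<close> equal to 0, so the value 2 includes
    finiteness.\<close>
  moreover have "finite {(\<Sigma>, i). \<Sigma> \<in> faces S K \<and> i < length (walk K \<Sigma>) \<and> fst (walk K \<Sigma> ! i) = e}"
    if "e \<in> edges K" for e
    using K that by (intro card_ge_0_finite) (simp add: decomposition_def)
  then have "finite (fst ` (\<Union>e\<in>edges K. {(\<Sigma>, i). \<Sigma> \<in> faces S K \<and> i < length (walk K \<Sigma>) \<and> fst (walk K \<Sigma> ! i) = e}))"
    using V(3) by blast
  ultimately show ?thesis
    using V(1) by (intro finite_subset[of "faces S K" "(\<lambda>v. topspace S - {v}) ` verts K \<union> fst ` (\<Union>e\<in>edges K. {(\<Sigma>, i). \<Sigma> \<in> faces S K \<and> i < length (walk K \<Sigma>) \<and> fst (walk K \<Sigma> ! i) = e})"]) auto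
qed

text \<open>The faces are the components of the complement of the skeleton, so attaching them all
  gives \<open>S\<close>. Each contributes 1 because its boundary circle has Euler characteristic
  0.\<close>

lemma euler_characteristic_decomposition:
  assumes S: "connected_compact_surface S" and K: "decomposition S K"
  shows "euler_characteristic S = int (card (verts K)) - int (card (edges K)) + int (card (faces S K))"
proof -
  have Hd: "Hausdorff_space S" using S by (simp add: connected_compact_surface_def)
  have G: "closedin S (skeleton K)"
    "has_euler (subtopology S (skeleton K)) {} (int (card (verts K)) - int (card (edges K)))"
    using has_euler_skeleton[OF Hd] K by (auto simp: decomposition_def)
  have F: "faces S K = connected_components_of (subtopology S (topspace S - skeleton K))"
    by (simp add: faces_def skeleton_def)
  have "has_euler (subtopology S (skeleton K \<union> (\<Union>\<Sigma>\<in>faces S K. \<Sigma>))) {}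
     (int (card (verts K)) - int (card (edges K)) + int (card (faces S K)) * (1 - 0))"
  proof (rule conjunct2[OF has_euler_attach_cells[OF Hd G(1) finite_faces[OF S K] _ _ _ G(2) has_euler_unit_circle]])
    fix \<Sigma> assume \<Sigma>: "\<Sigma> \<in> faces S K"
    show "\<exists>h. continuous_map (top_of_set (cball (0::complex) 1)) S h \<and>
        h ` sphere 0 1 \<subseteq> skeleton K \<and> inj_on h (ball 0 1) \<and> h ` ball 0 1 = \<Sigma>"
      using face_characteristic_map[OF K \<Sigma>] by metis
    show "disjnt \<Sigma> (skeleton K)"
      using connected_components_of_subset \<Sigma> unfolding F disjnt_def by fastforce
  next
    show "pairwise disjnt (faces S K)"
      unfolding F by (rule pairwise_disjoint_connected_components_of)
  qed
  moreover have "skeleton K \<union> (\<Union>\<Sigma>\<in>faces S K. \<Sigma>) = topspace S"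
    using Union_connected_components_of[of "subtopology S (topspace S - skeleton K)"]
      closedin_subset[OF G(1)] unfolding F by auto
  ultimately show ?thesis by (intro euler_characteristic_eqI) simp
qed

section \<open>Counting matched and unmatched cells\<close>

lemma
  fixes K :: "('a, 'e, 'm) cell_decomposition_scheme" and M :: "('a, 'e) incidence set"
  assumes K: "embedded_finite_graph S K" and M: "morse_matching_V S K M"
  shows sum_vertex_index: "(\<Sum>v\<in>verts K. vertex_index K M v) = real (card (verts K)) - real (card M)"
    and card_unmatched_edges: "card {e \<in> edges K. unmatched K M (ECell e)} + card M = card (edges K)"
proof -
  have fin: "finite (verts K)" "finite (edges K)"
    and ends: "\<And>e b. e \<in> edges K \<Longrightarrow> edge_end K e b \<in> verts K"
    using K by (auto simp: embedded_finite_graph_def)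
  \<comment> \<open>An incidence of the form \<open>EF\<close> has a face among its ends and so does
    not belong to the subgraph of vertices and edges.\<close>
  have ME: "\<exists>e b. a = VE e b \<and> e \<in> edges K" if "a \<in> M" for a
  proof -
    have "a \<in> hasse_edges S K" "\<exists>v e. hasse_ends K a = {VCell v, ECell e}"
      using M that by (auto simp: morse_matching_V_def hasse_edges_V_def)
    then show ?thesis by (auto simp: hasse_edges_def)
  qed
  have disj: "hasse_ends K a \<inter> hasse_ends K b = {}" if "a \<in> M" "b \<in> M" "a \<noteq> b" for a b
    using M that by (auto simp: morse_matching_V_def pairwise_def disjnt_def)
  define ve where "ve a = (case a of VE e b \<Rightarrow> edge_end K e b)" for a :: "('a, 'e) incidence"
  define ed where "ed a = (case a of VE e b \<Rightarrow> e)" for a :: "('a, 'e) incidence"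
  have he: "hasse_ends K a = {VCell (ve a), ECell (ed a)}" "ed a \<in> edges K" "ve a \<in> verts K" if "a \<in> M" for a
    using ME[OF that] ends by (auto simp: ve_def ed_def)
  \<comment> \<open>Two members of the matching with the same vertex or the same edge would have
    intersecting sets of ends.\<close>
  have inj: "inj_on ve M" "inj_on ed M"
    using disj he(1) by (auto simp: inj_on_def)
  have sub: "ve ` M \<subseteq> verts K" "ed ` M \<subseteq> edges K" using he by auto
  have un: "unmatched K M (VCell v) \<longleftrightarrow> v \<notin> ve ` M" "unmatched K M (ECell e) \<longleftrightarrow> e \<notin> ed ` M" for v e
    using he(1) by (auto simp: unmatched_def)
  have card_M: "card (ve ` M) = card M" "card (ed ` M) = card M"
    using inj by (auto intro: card_image)
  have "(\<Sum>v\<in>verts K. vertex_index K M v) = real (card (verts K - ve ` M))"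
    using fin by (simp add: vertex_index_def un sum.If_cases Diff_eq Compl_eq)
  also have "card (verts K - ve ` M) = card (verts K) - card M"
    using sub fin card_M by (simp add: card_Diff_subset finite_subset)
  finally show "(\<Sum>v\<in>verts K. vertex_index K M v) = real (card (verts K)) - real (card M)"
    using card_mono[OF fin(1) sub(1)] card_M by (simp add: of_nat_diff)
  have "{e \<in> edges K. unmatched K M (ECell e)} = edges K - ed ` M" using un by auto
  then show "card {e \<in> edges K. unmatched K M (ECell e)} + card M = card (edges K)"
    using card_mono[OF fin(2) sub(2)] sub fin card_M by (simp add: card_Diff_subset finite_subset)
qed

text \<open>Double counting of the pairs of a face and a position in its walk that carries an
  unmatched edge: grouped by face they give the left side, grouped by edge they give two for each
  unmatched edge.\<close>

lemma sum_unmatched_count: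
  assumes K: "decomposition S K" and fin: "finite (faces S K)"
  shows "(\<Sum>\<Sigma>\<in>faces S K. unmatched_count K M \<Sigma>) = 2 * card {e \<in> edges K. unmatched K M (ECell e)}"
proof -
  let ?T = "\<lambda>e. {(\<Sigma>, i). \<Sigma> \<in> faces S K \<and> i < length (walk K \<Sigma>) \<and> fst (walk K \<Sigma> ! i) = e}"
  let ?E = "{e \<in> edges K. unmatched K M (ECell e)}"
  let ?I = "\<lambda>\<Sigma>. {i. i < length (walk K \<Sigma>) \<and> unmatched K M (ECell (fst (walk K \<Sigma> ! i)))}"
  have finE: "finite (edges K)" and two: "\<And>e. e \<in> edges K \<Longrightarrow> card (?T e) = 2"
    using K by (auto simp: decomposition_def embedded_finite_graph_def)
  have w: "fst (walk K \<Sigma> ! i) \<in> edges K" if "\<Sigma> \<in> faces S K" "i < length (walk K \<Sigma>)" for \<Sigma> i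
    using K that by (auto simp: decomposition_def boundary_walk_def image_subset_iff)
  have "(\<Sum>\<Sigma>\<in>faces S K. unmatched_count K M \<Sigma>) = (\<Sum>\<Sigma>\<in>faces S K. card (?I \<Sigma>))"
    by (simp add: unmatched_count_def length_filter_conv_card)
  also have "\<dots> = card (Sigma (faces S K) ?I)"
    using fin by (simp add: card_SigmaI)
  also have "Sigma (faces S K) ?I = (\<Union>e\<in>?E. ?T e)"
    using w by auto
  also have "card \<dots> = (\<Sum>e\<in>?E. card (?T e))"
    using finE two by (intro card_UN_disjoint) (auto intro!: card_ge_0_finite)
  also have "\<dots> = 2 * card ?E" using two by simp
  finally show ?thesis .
qed

theorem theorem4:
  fixes S :: "'a topology"
    and K :: "('a, 'e) cell_decomposition"
    and M\<^sub>V :: "('a, 'e) incidence set"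
  assumes "connected_compact_surface S"
    and "discrete_gradient_line_field S K M\<^sub>V"
  shows "real_of_int (euler_characteristic S) =
    (\<Sum>v\<in>verts K. vertex_index K M\<^sub>V v) + (\<Sum>\<Sigma>\<in>faces S K. face_index K M\<^sub>V \<Sigma>)"
proof -
  have K: "decomposition S K" and M: "morse_matching_V S K M\<^sub>V" and G: "embedded_finite_graph S K"
    using assms(2) by (auto simp: discrete_gradient_line_field_def decomposition_def)
  let ?E = "{e \<in> edges K. unmatched K M\<^sub>V (ECell e)}"
  have "(\<Sum>\<Sigma>\<in>faces S K. face_index K M\<^sub>V \<Sigma>)
      = real (card (faces S K)) - real (\<Sum>\<Sigma>\<in>faces S K. unmatched_count K M\<^sub>V \<Sigma>) / 2"
    by (simp add: face_index_def sum_subtractf sum_divide_distrib)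
  also have "\<dots> = real (card (faces S K)) - real (card ?E)"
    by (simp add: sum_unmatched_count[OF K finite_faces[OF assms(1) K]])
  finally show ?thesis
    using euler_characteristic_decomposition[OF assms(1) K] sum_vertex_index[OF G M]
      card_unmatched_edges[OF G M] by simp
qed

end
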